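(* Let $\mathfrak{I}:\mathbb{X}_n\times\mathbb{X}_n\to\mathbb{R}$ be an $n$-symmetric $\mathrm{PDI}_n$ kernel that is zero on the extended diagonal $\Delta^n_{n-1}$, fix $x_{\vec 0}\in\mathbb{X}_n$, and let $K^{\mathfrak{I}}$ be the positive definite kernel on $\mathbb{X}_n$ associated with $\mathfrak{I}$ and $x_{\vec 0}$. Then for all $x_{\vec 1},x_{\vec 2}\in\mathbb{X}_n$ $$\Big\|\sum_{\alpha\in\{1,2\}^n}(-1)^{|\alpha|}K^{\mathfrak{I}}_{x_\alpha}\Big\|^2_{\mathcal{H}_{\mathfrak{I}}}=\sum_{\alpha,\beta\in\{1,2\}^n}(-1)^{|\alpha|+|\beta|}K^{\mathfrak{I}}(x_\alpha,x_\beta)=2^n\,\mathfrak{I}(x_{\vec 1},x_{\vec 2}).$$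
   Context: $X_1,\dots,X_n$ are nonempty sets, $\mathbb{X}_n=\prod_{i=1}^nX_i$. For points $x_{\vec 0},x_{\vec 1},x_{\vec 2}\in\mathbb{X}_n$, $x_{\vec a}=(x_1^a,\dots,x_n^a)$, and a multi-index $\alpha\in\{0,1,2\}^n$, put $x_\alpha=(x_1^{\alpha_1},\dots,x_n^{\alpha_n})$ and $|\alpha|=\alpha_1+\dots+\alpha_n$. A kernel $\mathfrak{I}:\mathbb{X}_n\times\mathbb{X}_n\to\mathbb{R}$ is $n$-symmetric if $\mathfrak{I}(x_{\vec 1},x_{\vec 2})=\mathfrak{I}(x_\alpha,x_{\vec 3-\alpha})$ for all $\alpha\in\{1,2\}^n$ and all $x_{\vec 1},x_{\vec 2}$, where $\vec 3-\alpha=(3-\alpha_1,\dots,3-\alpha_n)$. $\mathcal{M}(\mathbb{X}_n)$ is the vector space of finitely supported real signed measures on $\mathbb{X}_n$, and $\mathcal{M}_n(\mathbb{X}_n)$ is the set of $\mu\in\mathcal{M}(\mathbb{X}_n)$ with $\mu(\prod_{i=1}^nA_i)=0$ whenever $A_i\subset X_i$ and $A_i=X_i$ for at least one $i$. An $n$-symmetric kernel $\mathfrak{I}$ is $\mathrm{PDI}_n$ if $\iint(-1)^n\mathfrak{I}(u,v)\,d\mu(u)d\mu(v)\ge0$ for all $\mu\in\mathcal{M}_n(\mathbb{X}_n)$. $\Delta^n_{n-1}$ is the set of pairs $(x_{\vec 1},x_{\vec 2})$ having at least one coordinate $i$ with $x_i^1=x_i^2$. Put $\mu_n^n[x_{\vec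 1},x_{\vec 0}]=\bigotimes_{i=1}^n(\delta_{x_i^1}-\delta_{x_i^0})$ and, for fixed $x_{\vec 0}$, $$K^{\mathfrak{I}}(x_{\vec 1},x_{\vec 2})=\int\int(-1)^n\mathfrak{I}(u,v)\,d\mu_n^n[x_{\vec 1},x_{\vec 0}](u)\,d\mu_n^n[x_{\vec 2},x_{\vec 0}](v),$$ which is positive definite when $\mathfrak{I}$ is $\mathrm{PDI}_n$. $\mathcal{H}_{\mathfrak{I}}$ is the reproducing kernel Hilbert space of $K^{\mathfrak{I}}$, and $K^{\mathfrak{I}}_{z}=K^{\mathfrak{I}}(\cdot,z)\in\mathcal{H}_{\mathfrak{I}}$. Positive definite means all sums $\sum c_ic_jK(z_i,z_j)$ are nonnegative. *)

theory Defs
  imports "HOL-Analysis.Analysis" "HOL-Library.Poly_Mapping"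
begin

section \<open>Finitely supported signed measures\<close>

text \<open>
  A finitely supported real signed measure is represented by its mass function, a finitely
  supported map \<^typ>\<open>'x \<Rightarrow>\<^sub>0 real\<close>; the unit mass at \<open>x\<close> is \<open>Poly_Mapping.single x 1\<close>.
\<close>

definition fs_measures :: "'x set \<Rightarrow> ('x \<Rightarrow>\<^sub>0 real) set" where
  "fs_measures S = {\<mu>. Poly_Mapping.keys \<mu> \<subseteq> S}"

definition fs_measure :: "('x \<Rightarrow>\<^sub>0 real) \<Rightarrow> 'x set \<Rightarrow> real" where
  "fs_measure \<mu> A = (\<Sum>x\<in>Poly_Mapping.keys \<mu> \<inter> A. Poly_Mapping.lookup \<mu> x)"

definition fs_integral :: "('x \<Rightarrow>\<^sub>0 real) \<Rightarrow> ('x \<Rightarrow> real) \<Rightarrow> real" where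
  "fs_integral \<mu> f = (\<Sum>x\<in>Poly_Mapping.keys \<mu>. Poly_Mapping.lookup \<mu> x * f x)"

definition fs_dirac :: "'x \<Rightarrow> ('x \<Rightarrow>\<^sub>0 real)" where
  "fs_dirac x = Poly_Mapping.single x 1"

definition fs_product :: "nat \<Rightarrow> (nat \<Rightarrow> ('a \<Rightarrow>\<^sub>0 real)) \<Rightarrow> ((nat \<Rightarrow> 'a) \<Rightarrow>\<^sub>0 real)" where
  "fs_product n \<nu> = (\<Sum>x\<in>(\<Pi>\<^sub>E i\<in>{1..n}. Poly_Mapping.keys (\<nu> i)).
      Poly_Mapping.single x (\<Prod>i=1..n. Poly_Mapping.lookup (\<nu> i) (x i)))"


section \<open>Reproducing kernel Hilbert spaces\<close>

definition pos_def_kernel :: "'x set \<Rightarrow> ('x \<Rightarrow> 'x \<Rightarrow> real) \<Rightarrow> bool" where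
  "pos_def_kernel S K \<longleftrightarrow> (\<forall>(m::nat) (c :: nat \<Rightarrow> real) z. (\<forall>i<m. z i \<in> S) \<longrightarrow>
      (\<Sum>i<m. \<Sum>j<m. c i * c j * K (z i) (z j)) \<ge> 0)"

text \<open>
  Real functions on \<open>S\<close> are represented by functions on the whole type that vanish outside \<open>S\<close>.
\<close>

definition kernel_section :: "'x set \<Rightarrow> ('x \<Rightarrow> 'x \<Rightarrow> real) \<Rightarrow> 'x \<Rightarrow> 'x \<Rightarrow> real" where
  "kernel_section S K z = (\<lambda>u. if u \<in> S then K u z else 0)"

text \<open>
  A Hilbert space \<open>H\<close> of real functions on \<open>S\<close> with inner product \<open>ip\<close> and reproducing kernel
  \<open>K\<close>. The condition that \<open>ip\<close> vanishes outside \<open>H \<times> H\<close> has no mathematical content; it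
  only makes the pair \<open>(H, ip)\<close> unique as a pair of HOL objects.
\<close>

definition is_rkhs ::
  "'x set \<Rightarrow> ('x \<Rightarrow> 'x \<Rightarrow> real) \<Rightarrow> ('x \<Rightarrow> real) set \<Rightarrow> (('x \<Rightarrow> real) \<Rightarrow> ('x \<Rightarrow> real) \<Rightarrow> real) \<Rightarrow> bool"
where
  "is_rkhs S K H ip \<longleftrightarrow>
     (\<forall>f\<in>H. \<forall>u. u \<notin> S \<longrightarrow> f u = 0) \<and>
     (\<lambda>u. 0) \<in> H \<and>
     (\<forall>f\<in>H. \<forall>g\<in>H. (\<lambda>u. f u + g u) \<in> H) \<and>
     (\<forall>c. \<forall>f\<in>H. (\<lambda>u. c * f u) \<in> H) \<and>
     (\<forall>f\<in>H. \<forall>g\<in>H. ip f g = ip g f) \<and>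
     (\<forall>f\<in>H. \<forall>g\<in>H. \<forall>h\<in>H. ip (\<lambda>u. f u + g u) h = ip f h + ip g h) \<and>
     (\<forall>c. \<forall>f\<in>H. \<forall>h\<in>H. ip (\<lambda>u. c * f u) h = c * ip f h) \<and>
     (\<forall>f\<in>H. ip f f \<ge> 0 \<and> (ip f f = 0 \<longrightarrow> f = (\<lambda>u. 0))) \<and>
     (\<forall>F :: nat \<Rightarrow> 'x \<Rightarrow> real. (\<forall>k. F k \<in> H) \<longrightarrow>
        (\<forall>e>0. \<exists>M. \<forall>k\<ge>M. \<forall>m\<ge>M. sqrt (ip (\<lambda>u. F k u - F m u) (\<lambda>u. F k u - F m u)) < e) \<longrightarrow>
        (\<exists>f\<in>H. (\<lambda>k. sqrt (ip (\<lambda>u. F k u - f u) (\<lambda>u. F k u - f u))) \<longlonglongrightarrow> 0)) \<and>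
     (\<forall>z\<in>S. kernel_section S K z \<in> H) \<and>
     (\<forall>f\<in>H. \<forall>z\<in>S. ip f (kernel_section S K z) = f z) \<and>
     (\<forall>f g. f \<notin> H \<or> g \<notin> H \<longrightarrow> ip f g = 0)"

definition rkhs ::
  "'x set \<Rightarrow> ('x \<Rightarrow> 'x \<Rightarrow> real) \<Rightarrow> ('x \<Rightarrow> real) set \<times> (('x \<Rightarrow> real) \<Rightarrow> ('x \<Rightarrow> real) \<Rightarrow> real)"
where
  "rkhs S K = (THE R. is_rkhs S K (fst R) (snd R))"

definition rkhs_norm :: "'x set \<Rightarrow> ('x \<Rightarrow> 'x \<Rightarrow> real) \<Rightarrow> ('x \<Rightarrow> real) \<Rightarrow> real" where
  "rkhs_norm S K f = sqrt (snd (rkhs S K) f f)"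

subsection \<open>Existence and uniqueness (Moore--Aronszajn)\<close>

lemma fs_integral_superset:
  assumes "finite A" "Poly_Mapping.keys \<mu> \<subseteq> A"
  shows "fs_integral \<mu> f = (\<Sum>x\<in>A. Poly_Mapping.lookup \<mu> x * f x)"
  unfolding fs_integral_def
  by (rule sum.mono_neutral_left) (use assms in \<open>auto simp: in_keys_iff\<close>)

lemma fs_integral_zero [simp]: "fs_integral 0 f = 0"
  by (simp add: fs_integral_def)

lemma fs_integral_dirac [simp]: "fs_integral (fs_dirac x) f = f x"
  by (simp add: fs_integral_def fs_dirac_def)

lemma fs_integral_add_measure: "fs_integral (\<mu> + \<nu>) f = fs_integral \<mu> f + fs_integral \<nu> f"
proof -
  let ?A = "Poly_Mapping.keys \<mu> \<union> Poly_Mapping.keys \<nu>"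
  have "fs_integral (\<mu> + \<nu>) f = (\<Sum>x\<in>?A. Poly_Mapping.lookup (\<mu> + \<nu>) x * f x)"
    by (rule fs_integral_superset) (auto dest: Poly_Mapping.keys_add[THEN subsetD])
  also have "\<dots> = (\<Sum>x\<in>?A. Poly_Mapping.lookup \<mu> x * f x) + (\<Sum>x\<in>?A. Poly_Mapping.lookup \<nu> x * f x)"
    by (simp add: lookup_add sum.distrib algebra_simps)
  also have "\<dots> = fs_integral \<mu> f + fs_integral \<nu> f"
    by (simp add: fs_integral_superset[of ?A])
  finally show ?thesis .
qed

lemma fs_integral_diff_measure: "fs_integral (\<mu> - \<nu>) f = fs_integral \<mu> f - fs_integral \<nu> f"
  using fs_integral_add_measure[of "\<mu> - \<nu>" \<nu> f] by simp

definition fs_scale :: "real \<Rightarrow> ('x \<Rightarrow>\<^sub>0 real) \<Rightarrow> ('x \<Rightarrow>\<^sub>0 real)" where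
  "fs_scale c \<mu> = Poly_Mapping.map (\<lambda>y. c * y) \<mu>"

lemma lookup_fs_scale [simp]: "Poly_Mapping.lookup (fs_scale c \<mu>) x = c * Poly_Mapping.lookup \<mu> x"
  unfolding fs_scale_def by transfer (auto simp: when_def)

lemma keys_fs_scale: "Poly_Mapping.keys (fs_scale c \<mu>) \<subseteq> Poly_Mapping.keys \<mu>"
  by (auto simp: in_keys_iff)

lemma fs_integral_scale_measure: "fs_integral (fs_scale c \<mu>) f = c * fs_integral \<mu> f"
  by (subst fs_integral_superset[OF _ keys_fs_scale])
     (simp_all add: fs_integral_def sum_distrib_left algebra_simps)

lemma fs_integral_add: "fs_integral \<mu> (\<lambda>x. f x + g x) = fs_integral \<mu> f + fs_integral \<mu> g"
  by (simp add: fs_integral_def sum.distrib algebra_simps)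

lemma fs_integral_diff: "fs_integral \<mu> (\<lambda>x. f x - g x) = fs_integral \<mu> f - fs_integral \<mu> g"
  by (simp add: fs_integral_def sum_subtractf algebra_simps)

lemma fs_integral_scale: "fs_integral \<mu> (\<lambda>x. c * f x) = c * fs_integral \<mu> f"
  by (simp add: fs_integral_def sum_distrib_left algebra_simps)

lemma fs_integral_cong:
  "\<mu> \<in> fs_measures S \<Longrightarrow> (\<And>x. x \<in> S \<Longrightarrow> f x = g x) \<Longrightarrow> fs_integral \<mu> f = fs_integral \<mu> g"
  unfolding fs_integral_def fs_measures_def by (rule sum.cong) auto

lemma fs_integral_tendsto:
  "\<mu> \<in> fs_measures S \<Longrightarrow> (\<And>x. x \<in> S \<Longrightarrow> (\<lambda>k. F k x) \<longlonglongrightarrow> f x) \<Longrightarrow>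
     (\<lambda>k. fs_integral \<mu> (F k)) \<longlonglongrightarrow> fs_integral \<mu> f"
  unfolding fs_integral_def fs_measures_def by (intro tendsto_intros) auto

lemma fs_measures_zero [simp]: "0 \<in> fs_measures S"
  by (simp add: fs_measures_def)

lemma fs_measures_dirac [simp]: "fs_dirac x \<in> fs_measures S \<longleftrightarrow> x \<in> S"
  by (simp add: fs_measures_def fs_dirac_def)

lemma fs_measures_add: "\<mu> \<in> fs_measures S \<Longrightarrow> \<nu> \<in> fs_measures S \<Longrightarrow> \<mu> + \<nu> \<in> fs_measures S"
  using Poly_Mapping.keys_add[of \<mu> \<nu>] by (auto simp: fs_measures_def)

lemma fs_measures_diff: "\<mu> \<in> fs_measures S \<Longrightarrow> \<nu> \<in> fs_measures S \<Longrightarrow> \<mu> - \<nu> \<in> fs_measures S"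
  using keys_diff[of \<mu> \<nu>] by (auto simp: fs_measures_def)

lemma fs_measures_scale: "\<mu> \<in> fs_measures S \<Longrightarrow> fs_scale c \<mu> \<in> fs_measures S"
  using keys_fs_scale[of c \<mu>] by (auto simp: fs_measures_def)

lemmas fs_integral_linear = fs_integral_add_measure fs_integral_diff_measure
  fs_integral_scale_measure fs_integral_add fs_integral_diff fs_integral_scale

lemma pos_def_kernel_integral:
  assumes "pos_def_kernel S K" "\<mu> \<in> fs_measures S"
  shows "fs_integral \<mu> (\<lambda>u. fs_integral \<mu> (K u)) \<ge> 0"
proof -
  let ?A = "Poly_Mapping.keys \<mu>" and ?m = "Poly_Mapping.lookup \<mu>"
  obtain z where z: "bij_betw z {0..<card ?A} ?A"
    using ex_bij_betw_nat_finite[OF finite_keys] by blast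
  have *: "sum f ?A = (\<Sum>i<card ?A. f (z i))" for f :: "'a \<Rightarrow> real"
    using sum.reindex_bij_betw[OF z, of f] by (simp add: lessThan_atLeast0)
  have "z i \<in> S" if "i < card ?A" for i
    using z that assms(2) by (auto simp: bij_betw_def fs_measures_def)
  then have "(\<Sum>i<card ?A. \<Sum>j<card ?A. ?m (z i) * ?m (z j) * K (z i) (z j)) \<ge> 0"
    using assms(1) unfolding pos_def_kernel_def
    by (elim allE[of _ "card ?A"] allE[of _ "\<lambda>i. ?m (z i)"] allE[of _ z]) auto
  then show ?thesis
    unfolding fs_integral_def by (simp add: * sum_distrib_left mult.assoc)
qed

lemma is_rkhsD:
  assumes "is_rkhs S K H ip"
  shows "\<And>f u. f \<in> H \<Longrightarrow> u \<notin> S \<Longrightarrow> f u = 0"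
    and "(\<lambda>u. 0) \<in> H"
    and "\<And>f g. f \<in> H \<Longrightarrow> g \<in> H \<Longrightarrow> (\<lambda>u. f u + g u) \<in> H"
    and "\<And>c f. f \<in> H \<Longrightarrow> (\<lambda>u. c * f u) \<in> H"
    and "\<And>f g. f \<in> H \<Longrightarrow> g \<in> H \<Longrightarrow> ip f g = ip g f"
    and "\<And>f g h. f \<in> H \<Longrightarrow> g \<in> H \<Longrightarrow> h \<in> H \<Longrightarrow> ip (\<lambda>u. f u + g u) h = ip f h + ip g h"
    and "\<And>c f h. f \<in> H \<Longrightarrow> h \<in> H \<Longrightarrow> ip (\<lambda>u. c * f u) h = c * ip f h"
    and "\<And>f. f \<in> H \<Longrightarrow> ip f f \<ge> 0"
    and "\<And>F :: nat \<Rightarrow> 'x \<Rightarrow> real. (\<And>k. F k \<in> H) \<Longrightarrow>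
      (\<And>e. e > 0 \<Longrightarrow> \<exists>M. \<forall>k\<ge>M. \<forall>m\<ge>M. sqrt (ip (\<lambda>u. F k u - F m u) (\<lambda>u. F k u - F m u)) < e) \<Longrightarrow>
      (\<exists>f\<in>H. (\<lambda>k. sqrt (ip (\<lambda>u. F k u - f u) (\<lambda>u. F k u - f u))) \<longlonglongrightarrow> 0)"
    and "\<And>z. z \<in> S \<Longrightarrow> kernel_section S K z \<in> H"
    and "\<And>f z. f \<in> H \<Longrightarrow> z \<in> S \<Longrightarrow> ip f (kernel_section S K z) = f z"
    and "\<And>f g. f \<notin> H \<or> g \<notin> H \<Longrightarrow> ip f g = 0"
proof -
  note R = assms[unfolded is_rkhs_def]
  have "\<forall>f\<in>H. \<forall>g\<in>H. \<forall>h\<in>H. ip (\<lambda>u. f u + g u) h = ip f h + ip g h"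
    by (insert R, elim conjE, assumption)
  then show "\<And>f g h. f \<in> H \<Longrightarrow> g \<in> H \<Longrightarrow> h \<in> H \<Longrightarrow> ip (\<lambda>u. f u + g u) h = ip f h + ip g h"
    by blast
  have "\<forall>c. \<forall>f\<in>H. \<forall>h\<in>H. ip (\<lambda>u. c * f u) h = c * ip f h"
    by (insert R, elim conjE, assumption)
  then show "\<And>c f h. f \<in> H \<Longrightarrow> h \<in> H \<Longrightarrow> ip (\<lambda>u. c * f u) h = c * ip f h"
    by blast
qed (use assms[unfolded is_rkhs_def] in simp_all)

context
  fixes S :: "'x set" and K :: "'x \<Rightarrow> 'x \<Rightarrow> real"
  assumes sym: "\<And>u v. u \<in> S \<Longrightarrow> v \<in> S \<Longrightarrow> K u v = K v u"
    and pd: "pos_def_kernel S K"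
begin

private definition "B \<mu> \<nu> = fs_integral \<mu> (\<lambda>u. fs_integral \<nu> (K u))"

private definition "pot \<mu> = (\<lambda>u. if u \<in> S then fs_integral \<mu> (K u) else 0)"

private definition "sq f = (SUP \<mu>\<in>fs_measures S. 2 * fs_integral \<mu> f - B \<mu> \<mu>)"

private definition "HH = {f. (\<forall>u. u \<notin> S \<longrightarrow> f u = 0) \<and>
   bdd_above ((\<lambda>\<mu>. 2 * fs_integral \<mu> f - B \<mu> \<mu>) ` fs_measures S)}"

private lemma B_nonneg: "\<mu> \<in> fs_measures S \<Longrightarrow> B \<mu> \<mu> \<ge> 0"
  unfolding B_def by (rule pos_def_kernel_integral[OF pd])

private lemma B_sym:
  assumes "\<mu> \<in> fs_measures S" "\<nu> \<in> fs_measures S" shows "B \<mu> \<nu> = B \<nu> \<mu>"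
proof -
  have "B \<mu> \<nu> = (\<Sum>u\<in>Poly_Mapping.keys \<nu>. \<Sum>v\<in>Poly_Mapping.keys \<mu>.
     Poly_Mapping.lookup \<mu> v * (Poly_Mapping.lookup \<nu> u * K v u))"
    unfolding B_def fs_integral_def by (subst sum.swap) (simp add: sum_distrib_left)
  also have "\<dots> = B \<nu> \<mu>"
    unfolding B_def fs_integral_def sum_distrib_left
    by (intro sum.cong refl) (use assms sym in \<open>auto simp: fs_measures_def\<close>)
  finally show ?thesis .
qed

private lemma B_lin:
  "B (\<mu> + \<mu>') \<nu> = B \<mu> \<nu> + B \<mu>' \<nu>" "B \<nu> (\<mu> + \<mu>') = B \<nu> \<mu> + B \<nu> \<mu>'"
  "B (\<mu> - \<mu>') \<nu> = B \<mu> \<nu> - B \<mu>' \<nu>" "B \<nu> (\<mu> - \<mu>') = B \<nu> \<mu> - B \<nu> \<mu>'"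
  "B (fs_scale c \<mu>) \<nu> = c * B \<mu> \<nu>" "B \<nu> (fs_scale c \<mu>) = c * B \<nu> \<mu>"
  by (simp_all add: B_def fs_integral_linear)

private lemma int_pot: "\<mu> \<in> fs_measures S \<Longrightarrow> fs_integral \<mu> (pot \<nu>) = B \<mu> \<nu>"
  unfolding B_def by (rule fs_integral_cong[of \<mu> S]) (simp_all add: pot_def)

private lemma pot_lin:
  "pot (\<mu> + \<nu>) = (\<lambda>u. pot \<mu> u + pot \<nu> u)" "pot (\<mu> - \<nu>) = (\<lambda>u. pot \<mu> u - pot \<nu> u)"
  by (auto simp: pot_def fs_integral_linear)

private lemma pot_dirac: "pot (fs_dirac z) = kernel_section S K z"
  by (auto simp: pot_def kernel_section_def)

private lemma HH_supp: "f \<in> HH \<Longrightarrow> u \<notin> S \<Longrightarrow> f u = 0"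
  by (simp add: HH_def)

private lemma sq_upper: "f \<in> HH \<Longrightarrow> \<mu> \<in> fs_measures S \<Longrightarrow> 2 * fs_integral \<mu> f - B \<mu> \<mu> \<le> sq f"
  unfolding sq_def HH_def by (rule cSUP_upper) auto

private lemma sq_least:
  assumes "\<And>u. u \<notin> S \<Longrightarrow> f u = 0"
    and "\<And>\<mu>. \<mu> \<in> fs_measures S \<Longrightarrow> 2 * fs_integral \<mu> f - B \<mu> \<mu> \<le> C"
  shows "f \<in> HH" "sq f \<le> C"
proof -
  show "f \<in> HH" unfolding HH_def bdd_above_def using assms by auto
  have "fs_measures S \<noteq> {}" using fs_measures_zero by blast
  then show "sq f \<le> C" unfolding sq_def using assms(2) by (rule cSUP_least)
qed

private lemma sq_nonneg: "f \<in> HH \<Longrightarrow> sq f \<ge> 0"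
  using sq_upper[of f 0] by (simp add: B_def)

private lemma cauchy_schwarz:
  assumes f: "f \<in> HH" and m: "\<mu> \<in> fs_measures S"
  shows "\<bar>fs_integral \<mu> f\<bar> \<le> sqrt (sq f) * sqrt (B \<mu> \<mu>)"
proof -
  let ?a = "fs_integral \<mu> f" and ?q = "B \<mu> \<mu>" and ?N = "sq f"
  have *: "2 * t * ?a - t\<^sup>2 * ?q \<le> ?N" for t
    using sq_upper[OF f fs_measures_scale[OF m, of t]]
    by (simp add: fs_integral_linear B_lin power2_eq_square mult.assoc)
  have "?a\<^sup>2 \<le> ?N * ?q"
  proof (cases "?q = 0")
    case True
    have "?a = 0"
    proof (rule ccontr)
      assume "?a \<noteq> 0"
      then show False using *[of "(?N + 1) / (2 * ?a)"] True by simp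
    qed
    then show ?thesis using True by simp
  next
    case False
    then have q: "?q > 0" using B_nonneg[OF m] by simp
    have "?a\<^sup>2 / ?q \<le> ?N"
      using *[of "?a / ?q"] q by (simp add: power2_eq_square field_simps)
    then show ?thesis using q by (simp add: field_simps)
  qed
  then have "sqrt (?a\<^sup>2) \<le> sqrt (?N * ?q)" by (rule real_sqrt_le_mono)
  then show ?thesis by (simp add: real_sqrt_mult)
qed

private lemma sq_bound:
  assumes "\<And>u. u \<notin> S \<Longrightarrow> f u = 0"
    and "\<And>\<mu>. \<mu> \<in> fs_measures S \<Longrightarrow> \<bar>fs_integral \<mu> f\<bar> \<le> s * sqrt (B \<mu> \<mu>)"
  shows "f \<in> HH" "sq f \<le> s\<^sup>2"
proof -
  have "2 * fs_integral \<mu> f - B \<mu> \<mu> \<le> s\<^sup>2" if m: "\<mu> \<in> fs_measures S" for \<mu>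
  proof -
    have "2 * fs_integral \<mu> f \<le> 2 * s * sqrt (B \<mu> \<mu>)" using assms(2)[OF m] by linarith
    also have "\<dots> \<le> s\<^sup>2 + (sqrt (B \<mu> \<mu>))\<^sup>2"
      using sum_squares_bound[of s "sqrt (B \<mu> \<mu>)"] by simp
    finally show ?thesis using B_nonneg[OF m] by simp
  qed
  from sq_least[OF _ this] show "f \<in> HH" "sq f \<le> s\<^sup>2" using assms(1) by blast+
qed

private lemma HH_add:
  assumes "f \<in> HH" "g \<in> HH"
  shows "(\<lambda>u. f u + g u) \<in> HH" "sqrt (sq (\<lambda>u. f u + g u)) \<le> sqrt (sq f) + sqrt (sq g)"
proof -
  have "\<bar>fs_integral \<mu> (\<lambda>u. f u + g u)\<bar> \<le> (sqrt (sq f) + sqrt (sq g)) * sqrt (B \<mu> \<mu>)"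
    if "\<mu> \<in> fs_measures S" for \<mu>
    using cauchy_schwarz[OF assms(1) that] cauchy_schwarz[OF assms(2) that]
    by (simp add: fs_integral_linear algebra_simps)
  from sq_bound[OF _ this] show "(\<lambda>u. f u + g u) \<in> HH"
    and "sqrt (sq (\<lambda>u. f u + g u)) \<le> sqrt (sq f) + sqrt (sq g)"
    using assms by (auto simp: HH_supp sq_nonneg intro!: real_le_lsqrt)
qed

private lemma HH_scale:
  assumes "f \<in> HH"
  shows "(\<lambda>u. c * f u) \<in> HH" "sq (\<lambda>u. c * f u) \<le> c\<^sup>2 * sq f"
proof -
  have "\<bar>fs_integral \<mu> (\<lambda>u. c * f u)\<bar> \<le> (\<bar>c\<bar> * sqrt (sq f)) * sqrt (B \<mu> \<mu>)"
    if "\<mu> \<in> fs_measures S" for \<mu>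
    using mult_left_mono[OF cauchy_schwarz[OF assms that] abs_ge_zero[of c]]
    by (simp add: fs_integral_linear abs_mult mult.assoc)
  from sq_bound[OF _ this] show "(\<lambda>u. c * f u) \<in> HH" "sq (\<lambda>u. c * f u) \<le> c\<^sup>2 * sq f"
    using assms by (auto simp: HH_supp sq_nonneg power_mult_distrib)
qed

private lemma HH_diff:
  assumes "f \<in> HH" "g \<in> HH"
  shows "(\<lambda>u. f u - g u) \<in> HH" "sqrt (sq (\<lambda>u. f u - g u)) \<le> sqrt (sq f) + sqrt (sq g)"
proof -
  note a = HH_add[OF assms(1) HH_scale(1)[OF assms(2), of "-1"]]
  show "(\<lambda>u. f u - g u) \<in> HH" using a(1) by simp
  have "sqrt (sq (\<lambda>u. - 1 * g u)) \<le> sqrt (sq g)"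
    using HH_scale(2)[OF assms(2), of "-1"] by simp
  then show "sqrt (sq (\<lambda>u. f u - g u)) \<le> sqrt (sq f) + sqrt (sq g)" using a(2) by (simp del: real_sqrt_le_iff)
qed

private lemma sq_minus_commute:
  assumes "f \<in> HH" "g \<in> HH"
  shows "sq (\<lambda>u. f u - g u) = sq (\<lambda>u. g u - f u)"
  using HH_scale(2)[OF HH_diff(1)[OF assms], of "-1"]
    HH_scale(2)[OF HH_diff(1)[OF assms(2,1)], of "-1"] by simp

private lemma HH_pot:
  assumes n: "\<nu> \<in> fs_measures S"
  shows "pot \<nu> \<in> HH" "sq (pot \<nu>) = B \<nu> \<nu>"
proof -
  have "2 * fs_integral \<mu> (pot \<nu>) - B \<mu> \<mu> \<le> B \<nu> \<nu>" if m: "\<mu> \<in> fs_measures S" for \<mu>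
    using B_nonneg[OF fs_measures_diff[OF m n]]
    by (simp add: int_pot[OF m] B_lin B_sym[OF n m])
  from sq_least[OF _ this] have "pot \<nu> \<in> HH" "sq (pot \<nu>) \<le> B \<nu> \<nu>"
    by (auto simp: pot_def)
  moreover have "B \<nu> \<nu> \<le> sq (pot \<nu>)"
    using sq_upper[OF \<open>pot \<nu> \<in> HH\<close> n] by (simp add: int_pot[OF n])
  ultimately show "pot \<nu> \<in> HH" "sq (pot \<nu>) = B \<nu> \<nu>" by auto
qed

private lemma sq_shift:
  assumes f: "f \<in> HH" and n: "\<nu> \<in> fs_measures S"
  shows "sq (\<lambda>u. f u - pot \<nu> u) \<le> sq f - (2 * fs_integral \<nu> f - B \<nu> \<nu>)"
proof (rule sq_least(2))
  show "f u - pot \<nu> u = 0" if "u \<notin> S" for u using that HH_supp[OF f] by (simp add: pot_def)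
  fix \<mu> assume m: "\<mu> \<in> fs_measures S"
  show "2 * fs_integral \<mu> (\<lambda>u. f u - pot \<nu> u) - B \<mu> \<mu> \<le> sq f - (2 * fs_integral \<nu> f - B \<nu> \<nu>)"
    using sq_upper[OF f fs_measures_add[OF m n]]
    by (simp add: fs_integral_linear int_pot[OF m] B_lin B_sym[OF n m])
qed

private definition "approx a f \<longleftrightarrow> (\<forall>n::nat. a n \<in> fs_measures S) \<and>
  (\<lambda>n. sqrt (sq (\<lambda>u. f u - pot (a n) u))) \<longlonglongrightarrow> 0"

private lemma approx_ex:
  assumes f: "f \<in> HH"
  shows "\<exists>a. approx a f \<and> (\<lambda>n. 2 * fs_integral (a n) f - B (a n) (a n)) \<longlonglongrightarrow> sq f"
proof -
  have "\<exists>\<mu>\<in>fs_measures S. sq f - 1 / real (Suc n) < 2 * fs_integral \<mu> f - B \<mu> \<mu>" for n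
  proof (rule ccontr)
    assume "\<not> ?thesis"
    then have "sq f \<le> sq f - 1 / real (Suc n)"
      using sq_least(2)[of f "sq f - 1 / real (Suc n)"] HH_supp[OF f] by (meson not_less)
    then show False by simp
  qed
  then obtain a where a: "\<And>n. a n \<in> fs_measures S"
    "\<And>n. sq f - 1 / real (Suc n) < 2 * fs_integral (a n) f - B (a n) (a n)" by metis
  have lim: "(\<lambda>n. sq f - 1 / real (Suc n)) \<longlonglongrightarrow> sq f - 0"
    by (intro tendsto_intros LIMSEQ_Suc lim_1_over_n)
  have 1: "(\<lambda>n. 2 * fs_integral (a n) f - B (a n) (a n)) \<longlonglongrightarrow> sq f"
    by (rule tendsto_sandwich[OF _ _ _ tendsto_const])
       (use lim less_imp_le[OF a(2)] sq_upper[OF f a(1)] in auto)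
  have "(\<lambda>n. sq (\<lambda>u. f u - pot (a n) u)) \<longlonglongrightarrow> 0"
  proof (rule tendsto_sandwich[OF _ _ tendsto_const])
    show "(\<lambda>n. sq f - (2 * fs_integral (a n) f - B (a n) (a n))) \<longlonglongrightarrow> 0"
      using tendsto_diff[OF tendsto_const[of "sq f"] 1] by simp
  qed (use sq_shift[OF f a(1)] sq_nonneg[OF HH_diff(1)[OF f HH_pot(1)[OF a(1)]]] in auto)
  from tendsto_real_sqrt[OF this] 1 a(1) show ?thesis by (auto simp: approx_def)
qed

private lemma approx_dist:
  assumes g: "g \<in> HH" and m: "\<mu> \<in> fs_measures S" "\<nu> \<in> fs_measures S"
  shows "sqrt (B (\<mu> - \<nu>) (\<mu> - \<nu>)) \<le> sqrt (sq (\<lambda>u. g u - pot \<mu> u)) + sqrt (sq (\<lambda>u. g u - pot \<nu> u))"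
proof -
  have "pot (\<nu> - \<mu>) = (\<lambda>u. (g u - pot \<mu> u) - (g u - pot \<nu> u))" by (simp add: pot_lin)
  moreover have "B (\<mu> - \<nu>) (\<mu> - \<nu>) = B (\<nu> - \<mu>) (\<nu> - \<mu>)" by (simp add: B_lin)
  ultimately show ?thesis
    using HH_diff(2)[OF HH_diff(1)[OF g HH_pot(1)[OF m(1)]] HH_diff(1)[OF g HH_pot(1)[OF m(2)]]]
      HH_pot(2)[OF fs_measures_diff[OF m(2,1)]] by simp
qed

private definition "IP f g = (if f \<in> HH \<and> g \<in> HH
  then lim (\<lambda>n. fs_integral ((SOME a. approx a g) n) f) else 0)"

private lemma IP_lim:
  assumes f: "f \<in> HH" and g: "g \<in> HH" and a: "approx a g"
  shows "(\<lambda>n. fs_integral (a n) f) \<longlonglongrightarrow> IP f g"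
proof -
  let ?r = "\<lambda>a n. sqrt (sq (\<lambda>u. g u - pot (a n) u))"
  have close: "\<bar>fs_integral (a n) f - fs_integral (b m) f\<bar> \<le> sqrt (sq f) * (?r a n + ?r b m)"
    if "approx a g" "approx b g" for a b n m
  proof -
    have m: "a n \<in> fs_measures S" "b m \<in> fs_measures S" using that by (auto simp: approx_def)
    show ?thesis
      using cauchy_schwarz[OF f fs_measures_diff[OF m]]
        mult_left_mono[OF approx_dist[OF g m], of "sqrt (sq f)"] sq_nonneg[OF f]
      by (simp add: fs_integral_linear)
  qed
  define c where "c = (SOME a. approx a g)"
  have c: "approx c g" unfolding c_def using approx_ex[OF g] by (metis someI_ex)
  have r0: "(\<lambda>n. sqrt (sq f) * ?r b n) \<longlonglongrightarrow> 0" if "approx b g" for b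
    using that tendsto_mult_right_zero by (auto simp: approx_def)
  have "Cauchy (\<lambda>n. fs_integral (c n) f)"
  proof (rule metric_CauchyI)
    fix e :: real assume "e > 0"
    then obtain M where M: "\<And>n. n \<ge> M \<Longrightarrow> \<bar>sqrt (sq f) * ?r c n\<bar> < e / 2"
      using LIMSEQ_D[OF r0[OF c], of "e/2"] by auto
    have "dist (fs_integral (c m) f) (fs_integral (c n) f) < e" if "m \<ge> M" "n \<ge> M" for m n
      using close[OF c c, of m n] M[OF that(1)] M[OF that(2)]
      by (simp add: dist_real_def distrib_left)
    then show "\<exists>M. \<forall>m\<ge>M. \<forall>n\<ge>M. dist (fs_integral (c m) f) (fs_integral (c n) f) < e" by blast
  qed
  then have cl: "(\<lambda>n. fs_integral (c n) f) \<longlonglongrightarrow> IP f g"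
    using f g by (simp add: IP_def c_def Cauchy_convergent_iff convergent_LIMSEQ_iff)
  have "(\<lambda>n. fs_integral (a n) f - fs_integral (c n) f) \<longlonglongrightarrow> 0"
  proof (rule Lim_null_comparison)
    show "\<forall>\<^sub>F n in sequentially. norm (fs_integral (a n) f - fs_integral (c n) f)
        \<le> sqrt (sq f) * ?r a n + sqrt (sq f) * ?r c n"
      using close[OF a c] by (simp add: distrib_left)
    show "(\<lambda>n. sqrt (sq f) * ?r a n + sqrt (sq f) * ?r c n) \<longlonglongrightarrow> 0"
      using tendsto_add[OF r0[OF a] r0[OF c]] by simp
  qed
  from tendsto_add[OF this cl] show ?thesis by simp
qed

private lemma IP_B_lim:
  assumes f: "f \<in> HH" and g: "g \<in> HH" and a: "approx a f" and b: "approx b g"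
  shows "(\<lambda>n. B (b n) (a n)) \<longlonglongrightarrow> IP f g"
proof -
  let ?r = "\<lambda>n. sqrt (sq (\<lambda>u. f u - pot (a n) u))"
  let ?s = "\<lambda>n. sqrt (sq (\<lambda>u. g u - pot (b n) u))"
  have am: "a n \<in> fs_measures S" and bm: "b n \<in> fs_measures S" for n
    using a b by (auto simp: approx_def)
  have bb: "sqrt (B (b n) (b n)) \<le> sqrt (sq g) + ?s n" for n
    using HH_diff(2)[OF g HH_diff(1)[OF g HH_pot(1)[OF bm[of n]]]] HH_pot(2)[OF bm[of n]] by simp
  have "\<bar>fs_integral (b n) f - B (b n) (a n)\<bar> \<le> ?r n * (sqrt (sq g) + ?s n)" for n
  proof -
    have "fs_integral (b n) f - B (b n) (a n) = fs_integral (b n) (\<lambda>u. f u - pot (a n) u)"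
      by (simp add: fs_integral_linear int_pot[OF bm])
    also have "\<bar>\<dots>\<bar> \<le> ?r n * sqrt (B (b n) (b n))"
      by (rule cauchy_schwarz[OF HH_diff(1)[OF f HH_pot(1)[OF am]] bm])
    also have "\<dots> \<le> ?r n * (sqrt (sq g) + ?s n)"
      by (rule mult_left_mono[OF bb])
         (simp add: sq_nonneg[OF HH_diff(1)[OF f HH_pot(1)[OF am]]])
    finally show ?thesis .
  qed
  then have 1: "\<forall>\<^sub>F n in sequentially. norm (fs_integral (b n) f - B (b n) (a n))
      \<le> ?r n * (sqrt (sq g) + ?s n)"
    by (simp only: real_norm_def eventually_True)
  have "(\<lambda>n. ?r n * (sqrt (sq g) + ?s n)) \<longlonglongrightarrow> 0 * (sqrt (sq g) + 0)"
    using a b by (intro tendsto_intros) (auto simp: approx_def)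
  then have 2: "(\<lambda>n. ?r n * (sqrt (sq g) + ?s n)) \<longlonglongrightarrow> 0"
    by (simp only: mult_zero_left)
  have "(\<lambda>n. fs_integral (b n) f - B (b n) (a n)) \<longlonglongrightarrow> 0"
    by (rule Lim_null_comparison[OF 1 2])
  from tendsto_diff[OF IP_lim[OF f g b] this] show ?thesis by simp
qed

private lemma IP_sym: "IP f g = IP g f"
proof (cases "f \<in> HH \<and> g \<in> HH")
  case True
  then obtain a b where ab: "approx a f" "approx b g" using approx_ex by blast
  then have "B (b n) (a n) = B (a n) (b n)" for n by (intro B_sym) (auto simp: approx_def)
  then show ?thesis
    using IP_B_lim[of f g a b] IP_B_lim[of g f b a] ab True LIMSEQ_unique by auto
qed (auto simp: IP_def)

private lemma IP_self:
  assumes f: "f \<in> HH" shows "IP f f = sq f"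
proof -
  obtain a where a: "approx a f" "(\<lambda>n. 2 * fs_integral (a n) f - B (a n) (a n)) \<longlonglongrightarrow> sq f"
    using approx_ex[OF f] by blast
  have "(\<lambda>n. 2 * fs_integral (a n) f - B (a n) (a n)) \<longlonglongrightarrow> 2 * IP f f - IP f f"
    by (intro tendsto_intros IP_lim IP_B_lim f a)
  then show ?thesis using LIMSEQ_unique[OF a(2)] by fastforce
qed

private lemma pot_zero: "pot 0 = (\<lambda>u. 0)"
  by (simp add: pot_def fun_eq_iff)

private lemma approx_const: "\<mu> \<in> fs_measures S \<Longrightarrow> approx (\<lambda>_. \<mu>) (pot \<mu>)"
  using HH_pot(2)[of 0] by (simp add: approx_def pot_zero) (simp add: B_def)

private lemma HH_eval:
  assumes "f \<in> HH" "z \<in> S" shows "\<bar>f z\<bar> \<le> sqrt (sq f) * sqrt (K z z)"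
  using cauchy_schwarz[OF assms(1), of "fs_dirac z"] assms(2) by (simp add: B_def)

private lemma HH_complete:
  fixes F :: "nat \<Rightarrow> 'x \<Rightarrow> real"
  assumes F: "\<And>k. F k \<in> HH"
    and C: "\<And>e. e > 0 \<Longrightarrow> \<exists>M. \<forall>k\<ge>M. \<forall>m\<ge>M. sqrt (sq (\<lambda>u. F k u - F m u)) < e"
  shows "\<exists>f\<in>HH. (\<lambda>k. sqrt (sq (\<lambda>u. F k u - f u))) \<longlonglongrightarrow> 0"
proof -
  have "convergent (\<lambda>k. F k z)" for z
  proof (cases "z \<in> S")
    case True
    have kz: "K z z \<ge> 0" using B_nonneg[of "fs_dirac z"] True by (simp add: B_def)
    have "Cauchy (\<lambda>k. F k z)"
    proof (rule metric_CauchyI)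
      fix e :: real assume e: "e > 0"
      define d where "d = e / (sqrt (K z z) + 1)"
      have d: "d > 0" unfolding d_def using e kz by (intro divide_pos_pos add_nonneg_pos) auto
      obtain M where M: "\<And>k m. k \<ge> M \<Longrightarrow> m \<ge> M \<Longrightarrow> sqrt (sq (\<lambda>u. F k u - F m u)) < d"
        using C[OF d] by blast
      have "dist (F k z) (F m z) < e" if "k \<ge> M" "m \<ge> M" for k m
      proof -
        have "dist (F k z) (F m z) \<le> sqrt (sq (\<lambda>u. F k u - F m u)) * sqrt (K z z)"
          using HH_eval[OF HH_diff(1)[OF F F] True] by (simp add: dist_real_def)
        also have "\<dots> \<le> d * sqrt (K z z)"
          using M[OF that] kz by (intro mult_right_mono) auto
        also have "\<dots> < d * (sqrt (K z z) + 1)" using d by simp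
        also have "\<dots> = e"
        proof -
          have "sqrt (K z z) + 1 \<noteq> 0" using real_sqrt_ge_zero[OF kz] by linarith
          then show ?thesis by (simp add: d_def)
        qed
        finally show ?thesis .
      qed
      then show "\<exists>M. \<forall>m\<ge>M. \<forall>n\<ge>M. dist (F m z) (F n z) < e" by blast
    qed
    then show ?thesis by (simp add: Cauchy_convergent_iff)
  next
    case False
    then show ?thesis using HH_supp[OF F False] by (simp add: convergent_const)
  qed
  then obtain f where f: "\<And>z. (\<lambda>k. F k z) \<longlonglongrightarrow> f z" unfolding convergent_def by metis
  have f0: "f u = 0" if "u \<notin> S" for u
    using f[of u] HH_supp[OF F that] by (simp add: LIMSEQ_const_iff)
  have key: "(\<lambda>u. F k u - f u) \<in> HH \<and> sq (\<lambda>u. F k u - f u) \<le> e\<^sup>2"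
    if "\<And>m. m \<ge> M \<Longrightarrow> sqrt (sq (\<lambda>u. F k u - F m u)) < e" for e k M
  proof -
    have "2 * fs_integral \<mu> (\<lambda>u. F k u - f u) - B \<mu> \<mu> \<le> e\<^sup>2" if m: "\<mu> \<in> fs_measures S" for \<mu>
    proof (rule LIMSEQ_le_const2)
      show "(\<lambda>m. 2 * fs_integral \<mu> (\<lambda>u. F k u - F m u) - B \<mu> \<mu>)
          \<longlonglongrightarrow> 2 * fs_integral \<mu> (\<lambda>u. F k u - f u) - B \<mu> \<mu>"
        by (intro tendsto_intros fs_integral_tendsto[OF m] f)
      have "2 * fs_integral \<mu> (\<lambda>u. F k u - F j u) - B \<mu> \<mu> \<le> e\<^sup>2" if "j \<ge> M" for j
      proof -
        have "sq (\<lambda>u. F k u - F j u) = (sqrt (sq (\<lambda>u. F k u - F j u)))\<^sup>2"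
          by (simp add: sq_nonneg[OF HH_diff(1)[OF F F]])
        also have "\<dots> \<le> e\<^sup>2"
          using \<open>\<And>m. m \<ge> M \<Longrightarrow> sqrt (sq (\<lambda>u. F k u - F m u)) < e\<close>[OF that]
          by (intro power_mono) (auto simp: sq_nonneg[OF HH_diff(1)[OF F F]])
        finally show ?thesis using sq_upper[OF HH_diff(1)[OF F F] m] by (rule order_trans[rotated])
      qed
      then show "\<exists>N. \<forall>j\<ge>N. 2 * fs_integral \<mu> (\<lambda>u. F k u - F j u) - B \<mu> \<mu> \<le> e\<^sup>2" by blast
    qed
    from sq_least[OF _ this] show ?thesis using HH_supp[OF F] f0 by simp
  qed
  obtain M1 where "\<And>m. m \<ge> M1 \<Longrightarrow> sqrt (sq (\<lambda>u. F M1 u - F m u)) < 1"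
    using C[of 1] by auto
  from key[OF this] have "(\<lambda>u. F M1 u - f u) \<in> HH" by blast
  from HH_diff(1)[OF F[of M1] this] have fH: "f \<in> HH" by simp
  have "(\<lambda>k. sqrt (sq (\<lambda>u. F k u - f u))) \<longlonglongrightarrow> 0"
  proof (rule LIMSEQ_I)
    fix e :: real assume e: "e > 0"
    then obtain M where M: "\<And>k m. k \<ge> M \<Longrightarrow> m \<ge> M \<Longrightarrow> sqrt (sq (\<lambda>u. F k u - F m u)) < e / 2"
      using C[of "e/2"] by auto
    have "norm (sqrt (sq (\<lambda>u. F k u - f u)) - 0) < e" if "k \<ge> M" for k
    proof -
      have "sq (\<lambda>u. F k u - f u) \<le> (e / 2)\<^sup>2" using key[OF M[OF that]] by blast
      from real_sqrt_le_mono[OF this] show ?thesis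
        using e sq_nonneg[OF HH_diff(1)[OF F fH]] by simp
    qed
    then show "\<exists>M. \<forall>k\<ge>M. norm (sqrt (sq (\<lambda>u. F k u - f u)) - 0) < e" by blast
  qed
  with fH show ?thesis by blast
qed

private lemma rkhs_exists: "is_rkhs S K HH IP"
proof -
  have zero: "(\<lambda>u. 0) \<in> HH"
    using HH_pot(1)[of 0] by (simp add: pot_zero)
  have add: "IP (\<lambda>u. f u + g u) h = IP f h + IP g h" if fgh: "f \<in> HH" "g \<in> HH" "h \<in> HH" for f g h
  proof -
    obtain a where a: "approx a h" using approx_ex[OF fgh(3)] by blast
    have "(\<lambda>n. fs_integral (a n) f + fs_integral (a n) g) \<longlonglongrightarrow> IP f h + IP g h"
      by (intro tendsto_intros IP_lim a fgh)
    then show ?thesis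
      using IP_lim[OF HH_add(1)[OF fgh(1,2)] fgh(3) a] LIMSEQ_unique
      by (auto simp: fs_integral_linear)
  qed
  have scale: "IP (\<lambda>u. c * f u) h = c * IP f h" if fgh: "f \<in> HH" "h \<in> HH" for c f h
  proof -
    obtain a where a: "approx a h" using approx_ex[OF fgh(2)] by blast
    have "(\<lambda>n. c * fs_integral (a n) f) \<longlonglongrightarrow> c * IP f h"
      by (intro tendsto_intros IP_lim a fgh)
    then show ?thesis
      using IP_lim[OF HH_scale(1)[OF fgh(1)] fgh(2) a] LIMSEQ_unique
      by (auto simp: fs_integral_linear)
  qed
  have def0: "f = (\<lambda>u. 0)" if f: "f \<in> HH" and "IP f f = 0" for f
  proof
    fix u show "f u = 0"
      using HH_supp[OF f, of u] HH_eval[OF f, of u] that IP_self[OF f] by (cases "u \<in> S") auto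
  qed
  have sec: "kernel_section S K z \<in> HH" if "z \<in> S" for z
    using HH_pot(1)[of "fs_dirac z"] that by (simp add: pot_dirac)
  have rep: "IP f (kernel_section S K z) = f z" if "f \<in> HH" "z \<in> S" for f z
    using IP_lim[OF that(1) sec[OF that(2)], of "\<lambda>_. fs_dirac z"] approx_const[of "fs_dirac z"] that(2)
    by (simp add: pot_dirac LIMSEQ_const_iff)
  have comp: "\<exists>f\<in>HH. (\<lambda>k. sqrt (IP (\<lambda>u. F k u - f u) (\<lambda>u. F k u - f u))) \<longlonglongrightarrow> 0"
    if F: "\<forall>k. F k \<in> HH"
      and C: "\<forall>e>0. \<exists>M. \<forall>k\<ge>M. \<forall>m\<ge>M. sqrt (IP (\<lambda>u. F k u - F m u) (\<lambda>u. F k u - F m u)) < e"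
    for F :: "nat \<Rightarrow> 'x \<Rightarrow> real"
  proof -
    have e: "IP (\<lambda>u. F k u - f u) (\<lambda>u. F k u - f u) = sq (\<lambda>u. F k u - f u)" if "f \<in> HH" for f k
      by (rule IP_self[OF HH_diff(1)]) (use F that in auto)
    have "\<exists>f\<in>HH. (\<lambda>k. sqrt (sq (\<lambda>u. F k u - f u))) \<longlonglongrightarrow> 0"
      by (rule HH_complete) (use F C e in auto)
    then show ?thesis using e by auto
  qed
  show ?thesis
    unfolding is_rkhs_def
  proof (intro conjI)
    show "\<forall>f\<in>HH. 0 \<le> IP f f \<and> (IP f f = 0 \<longrightarrow> f = (\<lambda>u. 0))"
      using IP_self sq_nonneg def0 by simp
    show "\<forall>f g. f \<notin> HH \<or> g \<notin> HH \<longrightarrow> IP f g = 0" by (simp add: IP_def)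
  qed ((intro ballI allI impI)?,
      (rule zero HH_supp HH_add(1) HH_scale(1) IP_sym add scale comp sec rep; assumption))+
qed

private lemma rkhs_unique:
  assumes R: "is_rkhs S K H ip"
  shows "H = HH" "ip = IP"
proof -
  note supp = is_rkhsD(1)[OF R] and zero = is_rkhsD(2)[OF R] and addH = is_rkhsD(3)[OF R]
    and scaleH = is_rkhsD(4)[OF R] and comm = is_rkhsD(5)[OF R] and add = is_rkhsD(6)[OF R]
    and scale = is_rkhsD(7)[OF R] and pos = is_rkhsD(8)[OF R] and comp = is_rkhsD(9)[OF R]
    and sec = is_rkhsD(10)[OF R] and rep = is_rkhsD(11)[OF R] and out = is_rkhsD(12)[OF R]
  have diffH: "(\<lambda>u. f u - g u) \<in> H" if "f \<in> H" "g \<in> H" for f g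
    using addH[OF that(1) scaleH[OF that(2), of "-1"]] by simp
  have diff: "ip (\<lambda>u. f u - g u) h = ip f h - ip g h" if "f \<in> H" "g \<in> H" "h \<in> H" for f g h
    using add[OF that(1) scaleH[OF that(2), of "-1"] that(3)] scale[OF that(2,3), of "-1"] by simp
  have comb: "(\<lambda>u. \<Sum>z\<in>A. w z * kernel_section S K z u) \<in> H \<and>
      (\<forall>f\<in>H. ip (\<lambda>u. \<Sum>z\<in>A. w z * kernel_section S K z u) f = (\<Sum>z\<in>A. w z * f z))"
    if "finite A" "A \<subseteq> S" for A and w :: "'x \<Rightarrow> real"
    using that
  proof (induction A rule: finite_induct)
    case empty
    have "ip (\<lambda>u. 0) f = 0" if "f \<in> H" for f using scale[OF zero that, of 0] by simp
    then show ?case using zero by simp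
  next
    case (insert z A)
    have z: "z \<in> S" using insert by simp
    then have "ip (kernel_section S K z) f = f z" if "f \<in> H" for f
      using rep[OF that z] comm[OF that sec[OF z]] by simp
    then show ?case
      using insert z addH[OF scaleH[OF sec[OF z]]] add[OF scaleH[OF sec[OF z]]] scale[OF sec[OF z]]
      by simp
  qed
  have pot_sum: "pot \<mu> = (\<lambda>u. \<Sum>z\<in>Poly_Mapping.keys \<mu>. Poly_Mapping.lookup \<mu> z * kernel_section S K z u)" for \<mu>
    by (auto simp: pot_def fs_integral_def kernel_section_def)
  have potH: "pot \<mu> \<in> H" and ip_pot: "\<And>f. f \<in> H \<Longrightarrow> ip (pot \<mu>) f = fs_integral \<mu> f"
    if "\<mu> \<in> fs_measures S" for \<mu>
    using comb[of "Poly_Mapping.keys \<mu>" "Poly_Mapping.lookup \<mu>"] that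
    by (auto simp: pot_sum fs_integral_def fs_measures_def)
  have ip_pp: "ip (pot \<mu>) (pot \<mu>) = B \<mu> \<mu>" if "\<mu> \<in> fs_measures S" for \<mu>
    using ip_pot[OF that potH[OF that]] int_pot[OF that] by simp
  have ip_diff: "ip (\<lambda>u. f u - g u) (\<lambda>u. f u - g u) = ip f f - 2 * ip g f + ip g g"
    if "f \<in> H" "g \<in> H" for f g
    using diff[OF that diffH[OF that]] diff[OF that that(1)] diff[OF that that(2)]
      comm[OF diffH[OF that] that(1)] comm[OF diffH[OF that] that(2)] comm[OF that] by linarith
  have sub: "f \<in> HH \<and> sq f \<le> ip f f" if f: "f \<in> H" for f
  proof -
    have "2 * fs_integral \<mu> f - B \<mu> \<mu> \<le> ip f f" if m: "\<mu> \<in> fs_measures S" for \<mu>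
      using pos[OF diffH[OF f potH[OF m]]] ip_diff[OF f potH[OF m]] ip_pot[OF m f] ip_pp[OF m] by simp
    from sq_least[OF _ this] show ?thesis using supp[OF f] by blast
  qed
  have sup: "f \<in> H \<and> ip f f = sq f" if f: "f \<in> HH" for f
  proof -
    obtain a where a: "approx a f" "(\<lambda>n. 2 * fs_integral (a n) f - B (a n) (a n)) \<longlonglongrightarrow> sq f"
      using approx_ex[OF f] by blast
    then have am: "\<And>n. a n \<in> fs_measures S"
      and r: "(\<lambda>n. sqrt (sq (\<lambda>u. f u - pot (a n) u))) \<longlonglongrightarrow> 0" by (auto simp: approx_def)
    have "\<exists>M. \<forall>k\<ge>M. \<forall>m\<ge>M. sqrt (ip (\<lambda>u. pot (a k) u - pot (a m) u) (\<lambda>u. pot (a k) u - pot (a m) u)) < e"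
      if "e > 0" for e
    proof -
      obtain M where M: "\<And>n. n \<ge> M \<Longrightarrow> \<bar>sqrt (sq (\<lambda>u. f u - pot (a n) u))\<bar> < e / 2"
        using LIMSEQ_D[OF r, of "e/2"] \<open>e > 0\<close> by auto
      have "sqrt (ip (\<lambda>u. pot (a k) u - pot (a m) u) (\<lambda>u. pot (a k) u - pot (a m) u)) < e"
        if "k \<ge> M" "m \<ge> M" for k m
        using approx_dist[OF f am[of k] am[of m]] M[OF that(1)] M[OF that(2)]
          ip_pp[OF fs_measures_diff[OF am[of k] am[of m]]] by (simp add: pot_lin)
      then show ?thesis by blast
    qed
    with comp[of "\<lambda>k. pot (a k)"] potH[OF am] obtain h where h: "h \<in> H"
      "(\<lambda>k. sqrt (ip (\<lambda>u. pot (a k) u - h u) (\<lambda>u. pot (a k) u - h u))) \<longlonglongrightarrow> 0" by blast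
    have hH: "h \<in> HH" using sub[OF h(1)] by blast
    have "(\<lambda>k. sqrt (sq (\<lambda>u. pot (a k) u - h u))) \<longlonglongrightarrow> 0"
      by (rule tendsto_sandwich[OF _ _ tendsto_const h(2)])
         (use sub[OF diffH[OF potH[OF am] h(1)]] sq_nonneg[OF HH_diff(1)[OF HH_pot(1)[OF am] hH]] in auto)
    from tendsto_add[OF r this]
    have lim: "(\<lambda>k. sqrt (sq (\<lambda>u. f u - pot (a k) u)) + sqrt (sq (\<lambda>u. pot (a k) u - h u))) \<longlonglongrightarrow> 0"
      by simp
    have "sqrt (sq (\<lambda>u. f u - h u)) \<le> sqrt (sq (\<lambda>u. f u - pot (a k) u)) + sqrt (sq (\<lambda>u. pot (a k) u - h u))" for k
      using HH_add(2)[OF HH_diff(1)[OF f HH_pot(1)[OF am[of k]]] HH_diff(1)[OF HH_pot(1)[OF am[of k]] hH]]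
      by simp
    then have "sqrt (sq (\<lambda>u. f u - h u)) \<le> 0"
      using LIMSEQ_le_const[OF lim] by blast
    then have z: "sq (\<lambda>u. f u - h u) = 0"
      using sq_nonneg[OF HH_diff(1)[OF f hH]] by simp
    have "f = h"
    proof
      fix u show "f u = h u"
        using HH_eval[OF HH_diff(1)[OF f hH], of u] z HH_supp[OF f, of u] HH_supp[OF hH, of u]
        by (cases "u \<in> S") auto
    qed
    then have fH: "f \<in> H" using h by simp
    have "(\<lambda>k. (sqrt (ip (\<lambda>u. pot (a k) u - f u) (\<lambda>u. pot (a k) u - f u)))\<^sup>2) \<longlonglongrightarrow> 0\<^sup>2"
      using h(2) \<open>f = h\<close> by (intro tendsto_intros) simp
    moreover have "(sqrt (ip (\<lambda>u. pot (a k) u - f u) (\<lambda>u. pot (a k) u - f u)))\<^sup>2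
        = ip f f - (2 * fs_integral (a k) f - B (a k) (a k))" for k
      using pos[OF diffH[OF potH[OF am[of k]] fH]] ip_diff[OF potH[OF am[of k]] fH]
        ip_pot[OF am[of k] fH] ip_pp[OF am[of k]] comm[OF fH potH[OF am[of k]]] by simp
    ultimately have "(\<lambda>k. ip f f - (2 * fs_integral (a k) f - B (a k) (a k))) \<longlonglongrightarrow> 0" by simp
    moreover have "(\<lambda>k. ip f f - (2 * fs_integral (a k) f - B (a k) (a k))) \<longlonglongrightarrow> ip f f - sq f"
      by (intro tendsto_diff tendsto_const a)
    ultimately have "ip f f - sq f = 0" using LIMSEQ_unique by blast
    with fH show ?thesis by simp
  qed
  show HH: "H = HH" using sub sup by blast
  show "ip = IP"
  proof (intro ext)
    fix f g show "ip f g = IP f g"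
    proof (cases "f \<in> HH \<and> g \<in> HH")
      case True
      then have fg: "f \<in> H" "g \<in> H" using HH by auto
      obtain a where a: "approx a g" using approx_ex True by blast
      then have am: "\<And>n. a n \<in> fs_measures S"
        and r: "(\<lambda>n. sqrt (sq (\<lambda>u. g u - pot (a n) u))) \<longlonglongrightarrow> 0" by (auto simp: approx_def)
      have "ip f g = (ip f f + ip g g - sq (\<lambda>u. f u - g u)) / 2"
        using ip_diff[OF fg] sup[of "\<lambda>u. f u - g u"] HH_diff(1) True comm[OF fg] by auto
      moreover have "IP f g = (IP f f + IP g g - sq (\<lambda>u. f u - g u)) / 2"
      proof -
        have d: "(\<lambda>u. f u - g u) \<in> HH" and ng: "(\<lambda>u. - 1 * g u) \<in> HH" 
          using HH_diff(1) HH_scale(1) True by blast+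
        have D: "IP (\<lambda>u. f u - g u) h = IP f h - IP g h" if "h \<in> HH" for h
        proof -
          have "IP (\<lambda>u. f u + (- 1) * g u) h = IP f h + IP (\<lambda>u. (- 1) * g u) h"
            using is_rkhsD(6)[OF rkhs_exists, of f "\<lambda>u. (- 1) * g u" h] True ng that by blast
          moreover have "IP (\<lambda>u. (- 1) * g u) h = (- 1) * IP g h" using is_rkhsD(7)[OF rkhs_exists, of g h "-1"] True that by blast
          ultimately show ?thesis by simp
        qed
        have "sq (\<lambda>u. f u - g u) = IP f f - 2 * IP f g + IP g g"
          using IP_self[OF d] D[OF d] D[of f] D[of g] True
            IP_sym[of f "\<lambda>u. f u - g u"] IP_sym[of g "\<lambda>u. f u - g u"] IP_sym[of f g] by simp
        then show ?thesis by simp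
      qed
      ultimately show ?thesis using IP_self sup True by auto
    next
      case False
      then show ?thesis using out[of f g] HH by (auto simp: IP_def)
    qed
  qed
qed

theorem Moore_Aronszajn: "\<exists>!R. is_rkhs S K (fst R) (snd R)"
proof (rule ex1I[of _ "(HH, IP)"])
  show "is_rkhs S K (fst (HH, IP)) (snd (HH, IP))" using rkhs_exists by simp
  show "R = (HH, IP)" if "is_rkhs S K (fst R) (snd R)" for R
    using rkhs_unique[OF that] by (simp add: prod_eq_iff)
qed

corollary is_rkhs_rkhs: "is_rkhs S K (fst (rkhs S K)) (snd (rkhs S K))"
  unfolding rkhs_def by (rule theI'[OF Moore_Aronszajn])

end

section \<open>PDI kernels on products\<close>

text \<open>
  A product of \<open>X 1, \<dots>, X n\<close> is \<open>\<Pi>\<^sub>E i\<in>{1..n}. X i\<close>, and a family of points is a map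
  \<open>x :: nat \<Rightarrow> nat \<Rightarrow> 'a\<close> where \<open>x a i\<close> is the \<open>i\<close>-th coordinate of the point with upper
  index \<open>a\<close>.
\<close>

definition multi_indices :: "nat \<Rightarrow> nat set \<Rightarrow> (nat \<Rightarrow> nat) set" where
  "multi_indices n A = {1..n} \<rightarrow>\<^sub>E A"

definition multi_abs :: "nat \<Rightarrow> (nat \<Rightarrow> nat) \<Rightarrow> nat" where
  "multi_abs n \<alpha> = (\<Sum>i=1..n. \<alpha> i)"

definition point_at :: "nat \<Rightarrow> (nat \<Rightarrow> nat \<Rightarrow> 'a) \<Rightarrow> (nat \<Rightarrow> nat) \<Rightarrow> nat \<Rightarrow> 'a" where
  "point_at n x \<alpha> = (\<lambda>i\<in>{1..n}. x (\<alpha> i) i)"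

definition n_symmetric ::
  "nat \<Rightarrow> (nat \<Rightarrow> 'a set) \<Rightarrow> ((nat \<Rightarrow> 'a) \<Rightarrow> (nat \<Rightarrow> 'a) \<Rightarrow> real) \<Rightarrow> bool" where
  "n_symmetric n X J \<longleftrightarrow>
     (\<forall>x. x 1 \<in> Pi\<^sub>E {1..n} X \<and> x 2 \<in> Pi\<^sub>E {1..n} X \<longrightarrow>
       (\<forall>\<alpha>\<in>multi_indices n {1, 2}.
          J (x 1) (x 2) = J (point_at n x \<alpha>) (point_at n x (\<lambda>i\<in>{1..n}. 3 - \<alpha> i))))"

definition null_section_measures ::
  "nat \<Rightarrow> (nat \<Rightarrow> 'a set) \<Rightarrow> ((nat \<Rightarrow> 'a) \<Rightarrow>\<^sub>0 real) set" where
  "null_section_measures n X =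
     {\<mu> \<in> fs_measures (Pi\<^sub>E {1..n} X).
        \<forall>A. (\<forall>i\<in>{1..n}. A i \<subseteq> X i) \<and> (\<exists>i\<in>{1..n}. A i = X i) \<longrightarrow>
            fs_measure \<mu> (Pi\<^sub>E {1..n} A) = 0}"

definition PDI ::
  "nat \<Rightarrow> (nat \<Rightarrow> 'a set) \<Rightarrow> ((nat \<Rightarrow> 'a) \<Rightarrow> (nat \<Rightarrow> 'a) \<Rightarrow> real) \<Rightarrow> bool" where
  "PDI n X J \<longleftrightarrow> n_symmetric n X J \<and>
     (\<forall>\<mu>\<in>null_section_measures n X.
        fs_integral \<mu> (\<lambda>u. fs_integral \<mu> (\<lambda>v. (-1) ^ n * J u v)) \<ge> 0)"

definition extended_diagonal ::
  "nat \<Rightarrow> (nat \<Rightarrow> 'a set) \<Rightarrow> ((nat \<Rightarrow> 'a) \<times> (nat \<Rightarrow> 'a)) set" where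
  "extended_diagonal n X =
     {(u, v). u \<in> Pi\<^sub>E {1..n} X \<and> v \<in> Pi\<^sub>E {1..n} X \<and> (\<exists>i\<in>{1..n}. u i = v i)}"

definition diff_product :: "nat \<Rightarrow> (nat \<Rightarrow> 'a) \<Rightarrow> (nat \<Rightarrow> 'a) \<Rightarrow> ((nat \<Rightarrow> 'a) \<Rightarrow>\<^sub>0 real)" where
  "diff_product n p q = fs_product n (\<lambda>i. fs_dirac (p i) - fs_dirac (q i))"

definition assoc_kernel ::
  "nat \<Rightarrow> ((nat \<Rightarrow> 'a) \<Rightarrow> (nat \<Rightarrow> 'a) \<Rightarrow> real) \<Rightarrow> (nat \<Rightarrow> 'a) \<Rightarrow> (nat \<Rightarrow> 'a) \<Rightarrow> (nat \<Rightarrow> 'a) \<Rightarrow> real"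
where
  "assoc_kernel n J x0 y z =
     fs_integral (diff_product n y x0)
       (\<lambda>u. fs_integral (diff_product n z x0) (\<lambda>v. (-1) ^ n * J u v))"

end

theory Submission
  imports Defs
begin

text \<open>
  Integration against \<open>fs_product\<close> is multilinear, so the alternating sum over \<open>\<alpha>\<close> of the measures
  \<open>\<Otimes>\<^sub>i(\<delta>(x (\<alpha> i) i) - \<delta>(x 0 i))\<close> collapses to \<open>\<Otimes>\<^sub>i(\<delta>(x 2 i) - \<delta>(x 1 i))\<close>; the base point cancels.
  Expanding the latter, the double sum of \<open>K\<close> becomes the signed double sum of
  \<open>(-1)\<^sup>n J (x\<^sub>\<alpha>) (x\<^sub>\<beta>)\<close>. Vanishing on the extended diagonal leaves only \<open>\<beta> = 3 - \<alpha>\<close>, and by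
  \<open>n\<close>-symmetry each of these \<open>2\<^sup>n\<close> terms equals \<open>J (x 1) (x 2)\<close>.
\<close>

section \<open>Linearity of integrals in the measure and in the integrand\<close>

lemma fs_integral_single: "fs_integral (Poly_Mapping.single x c) f = c * f x"
  by (cases "c = 0") (simp_all add: fs_integral_def)

lemma fs_integral_sum_measure:
  "fs_integral (\<Sum>a\<in>A. \<mu> a) f = (\<Sum>a\<in>A. fs_integral (\<mu> a) f)"
  by (induction A rule: infinite_finite_induct) (simp_all add: fs_integral_add_measure)

lemma fs_integral_sum:
  "fs_integral \<mu> (\<lambda>u. \<Sum>a\<in>A. f a u) = (\<Sum>a\<in>A. fs_integral \<mu> (f a))"
  unfolding fs_integral_def sum_distrib_left by (rule sum.swap)

lemma fs_integral_swap:
  "fs_integral \<mu> (\<lambda>u. fs_integral \<nu> (f u)) = fs_integral \<nu> (\<lambda>v. fs_integral \<mu> (\<lambda>u. f u v))"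
  unfolding fs_integral_def sum_distrib_left
  by (subst sum.swap) (simp add: mult.left_commute)

lemma fs_measures_sum:
  "(\<And>a. a \<in> A \<Longrightarrow> \<mu> a \<in> fs_measures S) \<Longrightarrow> (\<Sum>a\<in>A. \<mu> a) \<in> fs_measures S"
  by (induction A rule: infinite_finite_induct) (simp_all add: fs_measures_add)

text \<open>Carries the linearity of \<open>fs_integral\<close> over to \<open>fs_measure\<close>,
  so that the null-section condition can be checked term by term.\<close>

lemma fs_measure_eq_integral: "fs_measure \<mu> A = fs_integral \<mu> (\<lambda>u. of_bool (u \<in> A))"
proof -
  have "fs_integral \<mu> (\<lambda>u. of_bool (u \<in> A))
      = (\<Sum>x\<in>Poly_Mapping.keys \<mu>. if x \<in> A then Poly_Mapping.lookup \<mu> x else 0)"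
    unfolding fs_integral_def by (intro sum.cong) auto
  then show ?thesis
    by (simp add: fs_measure_def sum.inter_restrict)
qed

section \<open>Product measures\<close>

lemma fs_product_cong:
  assumes "\<And>i. i \<in> {1..n} \<Longrightarrow> \<mu> i = \<nu> i"
  shows "fs_product n \<mu> = fs_product n \<nu>"
proof -
  have "Pi\<^sub>E {1..n} (\<lambda>i. Poly_Mapping.keys (\<mu> i)) = Pi\<^sub>E {1..n} (\<lambda>i. Poly_Mapping.keys (\<nu> i))"
    using assms by (intro PiE_cong) simp
  then show ?thesis
    unfolding fs_product_def using assms
    by (intro sum.cong arg_cong2[where f = Poly_Mapping.single] prod.cong) simp_all
qed

text \<open>The support grid may be enlarged: a point of the larger grid outside the supports has
  some coordinate of mass zero, so its whole product weight vanishes. Product measures with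
  different supports can then be summed over one grid.\<close>

lemma fs_integral_product:
  assumes "\<And>i. i \<in> {1..n} \<Longrightarrow> finite (A i)"
    and "\<And>i. i \<in> {1..n} \<Longrightarrow> Poly_Mapping.keys (\<nu> i) \<subseteq> A i"
  shows "fs_integral (fs_product n \<nu>) f
    = (\<Sum>w\<in>Pi\<^sub>E {1..n} A. (\<Prod>i=1..n. Poly_Mapping.lookup (\<nu> i) (w i)) * f w)"
proof -
  have "fs_integral (fs_product n \<nu>) f
     = (\<Sum>w\<in>(\<Pi>\<^sub>E i\<in>{1..n}. Poly_Mapping.keys (\<nu> i)). (\<Prod>i=1..n. Poly_Mapping.lookup (\<nu> i) (w i)) * f w)"
    by (simp add: fs_product_def fs_integral_sum_measure fs_integral_single)
  also have "\<dots> = (\<Sum>w\<in>Pi\<^sub>E {1..n} A. (\<Prod>i=1..n. Poly_Mapping.lookup (\<nu> i) (w i)) * f w)"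
  proof (rule sum.mono_neutral_left)
    show "finite (Pi\<^sub>E {1..n} A)" using assms(1) by (intro finite_PiE) auto
    show "(\<Pi>\<^sub>E i\<in>{1..n}. Poly_Mapping.keys (\<nu> i)) \<subseteq> Pi\<^sub>E {1..n} A"
      using assms(2) by (intro PiE_mono)
    show "\<forall>w\<in>Pi\<^sub>E {1..n} A - (\<Pi>\<^sub>E i\<in>{1..n}. Poly_Mapping.keys (\<nu> i)).
        (\<Prod>i=1..n. Poly_Mapping.lookup (\<nu> i) (w i)) * f w = 0"
    proof
      fix w assume w: "w \<in> Pi\<^sub>E {1..n} A - (\<Pi>\<^sub>E i\<in>{1..n}. Poly_Mapping.keys (\<nu> i))"
      then obtain i where "i \<in> {1..n}" "w i \<notin> Poly_Mapping.keys (\<nu> i)"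
        by (auto simp: PiE_iff)
      then have "(\<Prod>i=1..n. Poly_Mapping.lookup (\<nu> i) (w i)) = 0"
        by (intro prod_zero) (auto simp: in_keys_iff)
      then show "(\<Prod>i=1..n. Poly_Mapping.lookup (\<nu> i) (w i)) * f w = 0" by simp
    qed
  qed
  finally show ?thesis .
qed

lemma fs_integral_product_dirac:
  "fs_integral (fs_product n (\<lambda>i. fs_dirac (p i))) f = f (restrict p {1..n})"
proof -
  have "Pi\<^sub>E {1..n} (\<lambda>i. {p i}) = {restrict p {1..n}}"
    by (auto simp: PiE_iff extensional_def restrict_def fun_eq_iff)
  then show ?thesis
    by (subst fs_integral_product[where A = "\<lambda>i. {p i}"]) (simp_all add: fs_dirac_def)
qed

text \<open>On a common grid, the product over i of the sums over b expands into a sum over choice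
  functions \<alpha>; the two finite sums are then exchanged.\<close>

lemma fs_integral_product_multilinear:
  assumes "finite B"
    and lin: "\<And>i w. i \<in> {1..n} \<Longrightarrow>
      Poly_Mapping.lookup (\<mu> i) w = (\<Sum>b\<in>B. c b * Poly_Mapping.lookup (\<nu> i b) w)"
  shows "fs_integral (fs_product n \<mu>) f
    = (\<Sum>\<alpha>\<in>{1..n} \<rightarrow>\<^sub>E B. (\<Prod>i=1..n. c (\<alpha> i)) * fs_integral (fs_product n (\<lambda>i. \<nu> i (\<alpha> i))) f)"
proof -
  \<comment> \<open>One finite grid that contains the supports of \<open>\<mu> i\<close> and of
    every \<open>\<nu> i b\<close>.\<close>
  define A where "A i = Poly_Mapping.keys (\<mu> i) \<union> (\<Union>b\<in>B. Poly_Mapping.keys (\<nu> i b))" for i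
  have fin: "finite (A i)" for i using \<open>finite B\<close> by (simp add: A_def)
  have "fs_integral (fs_product n \<mu>) f
      = (\<Sum>w\<in>Pi\<^sub>E {1..n} A. (\<Prod>i=1..n. Poly_Mapping.lookup (\<mu> i) (w i)) * f w)"
    using fin by (intro fs_integral_product) (auto simp: A_def)
  also have "\<dots> = (\<Sum>w\<in>Pi\<^sub>E {1..n} A. \<Sum>\<alpha>\<in>{1..n} \<rightarrow>\<^sub>E B.
      (\<Prod>i=1..n. c (\<alpha> i)) * ((\<Prod>i=1..n. Poly_Mapping.lookup (\<nu> i (\<alpha> i)) (w i)) * f w))"
  proof (rule sum.cong[OF refl])
    fix w
    have "(\<Prod>i=1..n. Poly_Mapping.lookup (\<mu> i) (w i))
        = (\<Prod>i=1..n. \<Sum>b\<in>B. c b * Poly_Mapping.lookup (\<nu> i b) (w i))"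
      using lin by (intro prod.cong) auto
    also have "\<dots> = (\<Sum>\<alpha>\<in>{1..n} \<rightarrow>\<^sub>E B. \<Prod>i=1..n. c (\<alpha> i) * Poly_Mapping.lookup (\<nu> i (\<alpha> i)) (w i))"
      using \<open>finite B\<close> by (intro prod_sum_PiE) auto
    finally show "(\<Prod>i=1..n. Poly_Mapping.lookup (\<mu> i) (w i)) * f w = (\<Sum>\<alpha>\<in>{1..n} \<rightarrow>\<^sub>E B.
      (\<Prod>i=1..n. c (\<alpha> i)) * ((\<Prod>i=1..n. Poly_Mapping.lookup (\<nu> i (\<alpha> i)) (w i)) * f w))"
      by (simp add: sum_distrib_right prod.distrib mult.assoc)
  qed
  also have "\<dots> = (\<Sum>\<alpha>\<in>{1..n} \<rightarrow>\<^sub>E B. (\<Prod>i=1..n. c (\<alpha> i)) *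
      (\<Sum>w\<in>Pi\<^sub>E {1..n} A. (\<Prod>i=1..n. Poly_Mapping.lookup (\<nu> i (\<alpha> i)) (w i)) * f w))"
    unfolding sum_distrib_left by (rule sum.swap)
  also have "\<dots> = (\<Sum>\<alpha>\<in>{1..n} \<rightarrow>\<^sub>E B. (\<Prod>i=1..n. c (\<alpha> i)) * fs_integral (fs_product n (\<lambda>i. \<nu> i (\<alpha> i))) f)"
  proof (intro sum.cong refl arg_cong2[where f = "(*)"])
    fix \<alpha> assume "\<alpha> \<in> {1..n} \<rightarrow>\<^sub>E B"
    then show "(\<Sum>w\<in>Pi\<^sub>E {1..n} A. (\<Prod>i=1..n. Poly_Mapping.lookup (\<nu> i (\<alpha> i)) (w i)) * f w)
        = fs_integral (fs_product n (\<lambda>i. \<nu> i (\<alpha> i))) f"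
      using fin by (intro fs_integral_product[symmetric]) (auto simp: A_def PiE_iff)
  qed
  finally show ?thesis .
qed

section \<open>Differences of Dirac measures\<close>

lemma finite_multi_indices: "finite A \<Longrightarrow> finite (multi_indices n A)"
  by (simp add: multi_indices_def finite_PiE)

lemma point_at_mem:
  assumes "\<alpha> \<in> multi_indices n A" "\<And>a. a \<in> A \<Longrightarrow> x a \<in> Pi\<^sub>E {1..n} X"
  shows "point_at n x \<alpha> \<in> Pi\<^sub>E {1..n} X"
  using assms unfolding multi_indices_def point_at_def by (auto simp: PiE_iff)

text \<open>In each coordinate the signed sum over b = 1, 2 of \<delta>(x b i) - \<delta>(y i) is
  \<delta>(x 2 i) - \<delta>(x 1 i), because the two copies of \<delta>(y i) carry opposite signs.
  Multilinearity lifts this to the products.\<close>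

lemma diff_product_collapse:
  "(\<Sum>\<alpha>\<in>multi_indices n {1, 2}. (-1) ^ multi_abs n \<alpha> *
      fs_integral (diff_product n (point_at n x \<alpha>) y) f)
   = fs_integral (diff_product n (x 2) (x 1)) f"
proof -
  have "diff_product n (point_at n x \<alpha>) y = fs_product n (\<lambda>i. fs_dirac (x (\<alpha> i) i) - fs_dirac (y i))" for \<alpha>
    unfolding diff_product_def by (rule fs_product_cong) (simp add: point_at_def)
  moreover have "fs_integral (diff_product n (x 2) (x 1)) f
    = (\<Sum>\<alpha>\<in>{1..n} \<rightarrow>\<^sub>E {1, 2::nat}. (\<Prod>i=1..n. (-1) ^ \<alpha> i) *
        fs_integral (fs_product n (\<lambda>i. fs_dirac (x (\<alpha> i) i) - fs_dirac (y i))) f)"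
    unfolding diff_product_def
    by (rule fs_integral_product_multilinear[where \<nu> = "\<lambda>i b. fs_dirac (x b i) - fs_dirac (y i)"])
       (simp_all add: lookup_minus)
  ultimately show ?thesis
    by (simp add: multi_indices_def multi_abs_def power_sum)
qed

text \<open>The same multilinear expansion with plain Dirac factors: the measure is a signed sum of
  unit masses at the 2^n corners.\<close>

lemma fs_integral_diff_product:
  "fs_integral (diff_product n (x 2) (x 1)) f
   = (\<Sum>\<alpha>\<in>multi_indices n {1, 2}. (-1) ^ multi_abs n \<alpha> * f (point_at n x \<alpha>))"
proof -
  have "fs_integral (diff_product n (x 2) (x 1)) f
    = (\<Sum>\<alpha>\<in>{1..n} \<rightarrow>\<^sub>E {1, 2::nat}. (\<Prod>i=1..n. (-1) ^ \<alpha> i) *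
        fs_integral (fs_product n (\<lambda>i. fs_dirac (x (\<alpha> i) i))) f)"
    unfolding diff_product_def
    by (rule fs_integral_product_multilinear[where \<nu> = "\<lambda>i b. fs_dirac (x b i)"])
       (simp_all add: lookup_minus)
  then show ?thesis
    by (simp add: multi_indices_def multi_abs_def power_sum fs_integral_product_dirac point_at_def)
qed

lemma diff_product_measures:
  assumes "p \<in> Pi\<^sub>E {1..n} X" "q \<in> Pi\<^sub>E {1..n} X"
  shows "diff_product n p q \<in> fs_measures (Pi\<^sub>E {1..n} X)"
  unfolding diff_product_def fs_product_def
proof (rule fs_measures_sum)
  fix w assume w: "w \<in> (\<Pi>\<^sub>E i\<in>{1..n}. Poly_Mapping.keys (fs_dirac (p i) - fs_dirac (q i)))"
  have "Poly_Mapping.keys (fs_dirac (p i) - fs_dirac (q i)) \<subseteq> X i" if "i \<in> {1..n}" for i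
    using keys_diff[of "fs_dirac (p i)" "fs_dirac (q i)"] assms that
    by (auto simp: fs_dirac_def PiE_iff)
  then have "w \<in> Pi\<^sub>E {1..n} X" using w PiE_mono[of "{1..n}"] by blast
  then show "Poly_Mapping.single w (\<Prod>i=1..n. Poly_Mapping.lookup (fs_dirac (p i) - fs_dirac (q i)) (w i))
      \<in> fs_measures (Pi\<^sub>E {1..n} X)"
    by (auto simp: fs_measures_def split: if_splits)
qed

text \<open>The corner expansion turns the mass of a box into a sum over \<alpha> of products of
  indicators, which factors back coordinate by coordinate. In this form the mass visibly vanishes as
  soon as some A i contains both p i and q i.\<close>

lemma fs_measure_diff_product:
  "fs_measure (diff_product n p q) (Pi\<^sub>E {1..n} A)
    = (\<Prod>i=1..n. of_bool (p i \<in> A i) - of_bool (q i \<in> A i))"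
proof -
  \<comment> \<open>Index 2 carries the positive sign and hence p; index 1 gives q.\<close>
  define x where "x a = (if a = 2 then p else q)" for a :: nat
  have "fs_measure (diff_product n p q) (Pi\<^sub>E {1..n} A)
      = (\<Sum>\<alpha>\<in>{1..n} \<rightarrow>\<^sub>E {1, 2}. (\<Prod>i=1..n. (-1) ^ \<alpha> i) * of_bool (point_at n x \<alpha> \<in> Pi\<^sub>E {1..n} A))"
    using fs_integral_diff_product[of n x]
    by (simp add: fs_measure_eq_integral x_def multi_indices_def multi_abs_def power_sum)
  also have "\<dots> = (\<Sum>\<alpha>\<in>{1..n} \<rightarrow>\<^sub>E {1, 2}. \<Prod>i=1..n. (-1) ^ \<alpha> i * of_bool (x (\<alpha> i) i \<in> A i))"
  proof (rule sum.cong[OF refl])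
    fix \<alpha> :: "nat \<Rightarrow> nat"
    have "of_bool (point_at n x \<alpha> \<in> Pi\<^sub>E {1..n} A) = (\<Prod>i=1..n. of_bool (x (\<alpha> i) i \<in> A i) :: real)"
      by (cases "\<forall>i\<in>{1..n}. x (\<alpha> i) i \<in> A i") (auto simp: point_at_def PiE_iff intro!: prod_zero)
    then show "(\<Prod>i=1..n. (-1) ^ \<alpha> i) * of_bool (point_at n x \<alpha> \<in> Pi\<^sub>E {1..n} A)
        = (\<Prod>i=1..n. (-1) ^ \<alpha> i * of_bool (x (\<alpha> i) i \<in> A i) :: real)"
      by (simp add: prod.distrib)
  qed
  also have "\<dots> = (\<Prod>i=1..n. \<Sum>b\<in>{1, 2}. (-1) ^ b * of_bool (x b i \<in> A i))"
    by (rule prod_sum_PiE[symmetric]) auto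
  also have "\<dots> = (\<Prod>i=1..n. of_bool (p i \<in> A i) - of_bool (q i \<in> A i))"
    by (simp add: x_def del: sum_mult_of_bool_eq sum_of_bool_mult_eq)
  finally show ?thesis .
qed

text \<open>When A i = X i, both z a i and q i lie in A i, so the i-th factor of the box mass is 1 -
  1. These combinations are the measures on which the \<open>PDI\<close> inequality is tested
  below.\<close>

lemma null_section_measures_sum_diff_product:
  assumes "\<And>a. a \<in> F \<Longrightarrow> z a \<in> Pi\<^sub>E {1..n} X" "q \<in> Pi\<^sub>E {1..n} X"
  shows "(\<Sum>a\<in>F. fs_scale (c a) (diff_product n (z a) q)) \<in> null_section_measures n X"
proof -
  have "fs_measure (\<Sum>a\<in>F. fs_scale (c a) (diff_product n (z a) q)) (Pi\<^sub>E {1..n} A) = 0"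
    if "i \<in> {1..n}" "A i = X i" for A i
  proof -
    have "fs_measure (diff_product n (z a) q) (Pi\<^sub>E {1..n} A) = 0" if "a \<in> F" for a
      unfolding fs_measure_diff_product
      by (rule prod_zero)
         (use assms(1)[OF that] assms(2) \<open>i \<in> _\<close> \<open>A i = X i\<close> in \<open>auto simp: PiE_iff intro!: bexI[of _ i]\<close>)
    then show ?thesis
      by (simp add: fs_measure_eq_integral fs_integral_sum_measure fs_integral_scale_measure)
  qed
  then show ?thesis
    unfolding null_section_measures_def
    using fs_measures_sum[OF fs_measures_scale[OF diff_product_measures[OF assms]]] by auto
qed

section \<open>The associated kernel\<close>

text \<open>The constant multi-index 2 exchanges all coordinates at once, since its complement 3 - 2
  is the constant 1.\<close>

lemma n_symmetric_commute:
  assumes "n_symmetric n X J" "u \<in> Pi\<^sub>E {1..n} X" "v \<in> Pi\<^sub>E {1..n} X"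
  shows "J u v = J v u"
proof -
  define x where "x a = (if a = 1 then u else v)" for a :: nat
  have "x 1 \<in> Pi\<^sub>E {1..n} X \<and> x 2 \<in> Pi\<^sub>E {1..n} X" "(\<lambda>i\<in>{1..n}. 2) \<in> multi_indices n {1, 2}"
    using assms(2,3) by (auto simp: x_def multi_indices_def)
  then have "J (x 1) (x 2) = J (point_at n x (\<lambda>i\<in>{1..n}. 2))
      (point_at n x (\<lambda>i\<in>{1..n}. 3 - (\<lambda>i\<in>{1..n}. 2) i))"
    using assms(1) unfolding n_symmetric_def by blast
  moreover have "point_at n x (\<lambda>i\<in>{1..n}. 2) = restrict v {1..n}"
    "point_at n x (\<lambda>i\<in>{1..n}. 3 - (\<lambda>i\<in>{1..n}. 2) i) = restrict u {1..n}"
    by (auto simp: x_def point_at_def)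
  \<comment> \<open>\<open>point_at\<close> restricts to {1..n}; points of the product are
    extensional, so they are left unchanged.\<close>
  moreover have "restrict u {1..n} = u" "restrict v {1..n} = v"
    using assms(2,3) by (auto intro: PiE_restrict)
  ultimately show ?thesis by (simp add: x_def)
qed

text \<open>Exchange the order of integration, then use the symmetry of J. That symmetry is known on
  the product set only, which suffices because both measures are supported there.\<close>

lemma assoc_kernel_commute:
  assumes "n_symmetric n X J" "q \<in> Pi\<^sub>E {1..n} X" "y \<in> Pi\<^sub>E {1..n} X" "z \<in> Pi\<^sub>E {1..n} X"
  shows "assoc_kernel n J q y z = assoc_kernel n J q z y"
proof -
  note m = diff_product_measures[OF _ assms(2)]
  have "assoc_kernel n J q y z = fs_integral (diff_product n z q)
       (\<lambda>v. fs_integral (diff_product n y q) (\<lambda>u. (-1) ^ n * J u v))"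
    unfolding assoc_kernel_def by (rule fs_integral_swap)
  also have "\<dots> = assoc_kernel n J q z y"
    unfolding assoc_kernel_def
    by (intro fs_integral_cong[OF m[OF assms(4)]] fs_integral_cong[OF m[OF assms(3)]])
       (simp add: n_symmetric_commute[OF assms(1)])
  finally show ?thesis .
qed

text \<open>The quadratic form is a double integral against a single measure, the combination of the
  \<open>diff_product n (z i) q\<close> with coefficients c i. This measure vanishes on sections, so
  the \<open>PDI\<close> inequality applies to it.\<close>

lemma pos_def_assoc_kernel:
  assumes "PDI n X J" "q \<in> Pi\<^sub>E {1..n} X"
  shows "pos_def_kernel (Pi\<^sub>E {1..n} X) (assoc_kernel n J q)"
  unfolding pos_def_kernel_def
proof (intro allI impI)
  fix m :: nat and c :: "nat \<Rightarrow> real" and z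
  assume z: "\<forall>i<m. z i \<in> Pi\<^sub>E {1..n} X"
  define \<mu> where "\<mu> = (\<Sum>i<m. fs_scale (c i) (diff_product n (z i) q))"
  have "\<mu> \<in> null_section_measures n X"
    unfolding \<mu>_def by (rule null_section_measures_sum_diff_product) (use z assms(2) in auto)
  then have "fs_integral \<mu> (\<lambda>u. fs_integral \<mu> (\<lambda>v. (-1) ^ n * J u v)) \<ge> 0"
    using assms(1) by (simp add: PDI_def)
  also have "fs_integral \<mu> (\<lambda>u. fs_integral \<mu> (\<lambda>v. (-1) ^ n * J u v))
      = (\<Sum>i<m. \<Sum>j<m. c i * c j * assoc_kernel n J q (z i) (z j))"
  proof -
    have I: "fs_integral \<mu> g = (\<Sum>i<m. c i * fs_integral (diff_product n (z i) q) g)" for g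
      by (simp add: \<mu>_def fs_integral_sum_measure fs_integral_scale_measure)
    have "fs_integral \<mu> (\<lambda>u. fs_integral \<mu> (\<lambda>v. (-1) ^ n * J u v))
        = (\<Sum>i<m. c i * fs_integral (diff_product n (z i) q) (\<lambda>u. fs_integral \<mu> (\<lambda>v. (-1) ^ n * J u v)))"
      by (rule I)
    also have "\<dots> = (\<Sum>i<m. \<Sum>j<m. c i * c j * assoc_kernel n J q (z i) (z j))"
      by (simp only: I assoc_kernel_def fs_integral_sum fs_integral_scale sum_distrib_left mult.assoc
          mult.left_commute[of "c _" "(-1) ^ n"])
    finally show ?thesis .
  qed
  finally show "0 \<le> (\<Sum>i<m. \<Sum>j<m. c i * c j * assoc_kernel n J q (z i) (z j))" .
qed

section \<open>Alternating double sums over multi-indices\<close>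

text \<open>Both sides are the double integral of (-1)^n J against
  \<open>diff_product n (x 2) (x 1)\<close>: on the left the signed measures collapse and q
  disappears, on the right the measure is expanded at its corners.\<close>

lemma assoc_kernel_alternating_sum:
  "(\<Sum>\<alpha>\<in>multi_indices n {1, 2}. \<Sum>\<beta>\<in>multi_indices n {1, 2}.
      (-1) ^ (multi_abs n \<alpha> + multi_abs n \<beta>) * assoc_kernel n J q (point_at n x \<alpha>) (point_at n x \<beta>))
   = (\<Sum>\<alpha>\<in>multi_indices n {1, 2}. \<Sum>\<beta>\<in>multi_indices n {1, 2}.
      (-1) ^ (multi_abs n \<alpha> + multi_abs n \<beta>) * ((-1) ^ n * J (point_at n x \<alpha>) (point_at n x \<beta>)))"
  (is "?L = ?R")
proof -
  let ?I = "multi_indices n {1, 2}" and ?d = "\<lambda>\<alpha>. diff_product n (point_at n x \<alpha>) q"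
    and ?D = "diff_product n (x 2) (x 1)"
  have "?L = (\<Sum>\<alpha>\<in>?I. (-1) ^ multi_abs n \<alpha> * fs_integral (?d \<alpha>)
      (\<lambda>u. \<Sum>\<beta>\<in>?I. (-1) ^ multi_abs n \<beta> * fs_integral (?d \<beta>) (\<lambda>v. (-1) ^ n * J u v)))"
    by (simp only: assoc_kernel_def fs_integral_sum fs_integral_scale sum_distrib_left power_add mult.assoc)
  also have "\<dots> = fs_integral ?D (\<lambda>u. fs_integral ?D (\<lambda>v. (-1) ^ n * J u v))"
    by (simp only: diff_product_collapse)
  also have "\<dots> = ?R"
    by (simp only: fs_integral_diff_product sum_distrib_left power_add mult.assoc)
  finally show ?thesis .
qed

text \<open>Entries are 1 or 2, so a \<beta> other than 3 - \<alpha> agrees with \<alpha> in some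
  coordinate i, and the two corners then share their i-th coordinate.\<close>

lemma alternating_sum_off_diagonal:
  assumes sym: "n_symmetric n X J"
    and diag: "\<And>u v. (u, v) \<in> extended_diagonal n X \<Longrightarrow> J u v = 0"
    and x: "x 1 \<in> Pi\<^sub>E {1..n} X" "x 2 \<in> Pi\<^sub>E {1..n} X"
  shows "(\<Sum>\<alpha>\<in>multi_indices n {1, 2}. \<Sum>\<beta>\<in>multi_indices n {1, 2}.
      (-1) ^ (multi_abs n \<alpha> + multi_abs n \<beta>) * ((-1) ^ n * J (point_at n x \<alpha>) (point_at n x \<beta>)))
    = 2 ^ n * J (x 1) (x 2)"
proof -
  let ?I = "multi_indices n {1, 2}"
  have pt: "point_at n x \<alpha> \<in> Pi\<^sub>E {1..n} X" if "\<alpha> \<in> ?I" for \<alpha>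
    using that by (rule point_at_mem) (use x in auto)
  have "(\<Sum>\<beta>\<in>?I. (-1) ^ (multi_abs n \<alpha> + multi_abs n \<beta>) *
      ((-1) ^ n * J (point_at n x \<alpha>) (point_at n x \<beta>))) = J (x 1) (x 2)"
    (is "sum ?f ?I = _") if \<alpha>: "\<alpha> \<in> ?I" for \<alpha>
  proof -
    define \<gamma> where "\<gamma> = (\<lambda>i\<in>{1..n}. 3 - \<alpha> i)"
    have val: "\<alpha> i = 1 \<or> \<alpha> i = 2" if "i \<in> {1..n}" for i
      using \<alpha> that by (auto simp: multi_indices_def PiE_iff)
    have \<gamma>: "\<gamma> \<in> ?I"
      using val by (fastforce simp: multi_indices_def \<gamma>_def)
    have "?f \<beta> = 0" if \<beta>: "\<beta> \<in> ?I - {\<gamma>}" for \<beta>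
    proof -
      have ext: "\<beta> \<in> extensional {1..n}" "\<gamma> \<in> extensional {1..n}"
        using \<beta> \<gamma> by (auto simp: multi_indices_def PiE_iff)
      \<comment> \<open>Distinct extensional functions differ somewhere in {1..n}; with only two
        values available, differing from 3 - \<alpha> i means equalling \<alpha> i.\<close>
      obtain i where i: "i \<in> {1..n}" "\<beta> i \<noteq> \<gamma> i"
        using extensionalityI[OF ext] \<beta> by blast
      then have "\<beta> i = \<alpha> i"
        using val[OF i(1)] \<beta> by (auto simp: multi_indices_def PiE_iff \<gamma>_def)
      then have "(point_at n x \<alpha>, point_at n x \<beta>) \<in> extended_diagonal n X"
        using pt[OF \<alpha>] pt[of \<beta>] \<beta> i(1)
        by (auto simp: extended_diagonal_def intro!: bexI[of _ i]) (simp add: point_at_def)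
      then show ?thesis by (simp add: diag)
    qed
    then have "sum ?f ?I = sum ?f {\<gamma>}"
      using \<gamma> by (intro sum.mono_neutral_right finite_multi_indices) auto
    \<comment> \<open>Complementary entries add up to 3 in each coordinate. The sign (-1)^(3n),
      multiplied by the factor (-1)^n in front of J, is (-1)^(4n) = 1.\<close>
    moreover have "multi_abs n \<alpha> + multi_abs n \<gamma> = (\<Sum>i=1..n. 3)"
      unfolding multi_abs_def \<gamma>_def sum.distrib[symmetric]
      by (rule sum.cong) (use val in force)+
    moreover have "J (point_at n x \<alpha>) (point_at n x \<gamma>) = J (x 1) (x 2)"
      using sym x \<alpha> unfolding n_symmetric_def \<gamma>_def by metis
    moreover have "(-1::real) ^ (n * 3) * (-1) ^ n = 1"
      by (simp flip: power_add add: power_minus1_even minus_one_power_iff)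
    ultimately show ?thesis by simp
  qed
  then have "(\<Sum>\<alpha>\<in>?I. sum (\<lambda>\<beta>. (-1) ^ (multi_abs n \<alpha> + multi_abs n \<beta>) *
      ((-1) ^ n * J (point_at n x \<alpha>) (point_at n x \<beta>))) ?I) = real (card ?I) * J (x 1) (x 2)"
    by simp
  moreover have "card ?I = 2 ^ n"
    by (simp add: multi_indices_def card_PiE numeral_2_eq_2)
  ultimately show ?thesis by simp
qed

section \<open>Norms of finite combinations of kernel sections\<close>

text \<open>By the reproducing property, pairing the combination with f in H gives the weighted sum
  of the values f (z a); taking f to be the combination itself gives the quadratic form. Symmetry is
  assumed separately because \<open>pos_def_kernel\<close> does not contain it.\<close>

lemma rkhs_norm_sum_kernel_sections:
  assumes "\<And>u v. u \<in> S \<Longrightarrow> v \<in> S \<Longrightarrow> K u v = K v u" "pos_def_kernel S K"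
    and A: "finite A" "\<And>a. a \<in> A \<Longrightarrow> z a \<in> S"
  shows "(rkhs_norm S K (\<lambda>u. \<Sum>a\<in>A. c a * kernel_section S K (z a) u))\<^sup>2
    = (\<Sum>a\<in>A. \<Sum>b\<in>A. c a * c b * K (z a) (z b))"
proof -
  \<comment> \<open>\<open>rkhs\<close> is a definite description, so its defining property comes
    from existence and uniqueness.\<close>
  obtain H ip where R: "rkhs S K = (H, ip)" by fastforce
  have "is_rkhs S K H ip"
    using is_rkhs_rkhs[OF assms(1,2)] R by simp
  note D = is_rkhsD[OF this]
  \<comment> \<open>Membership and the pairing formula are proved together, since additivity of
    \<open>ip\<close> requires the partial sums to lie in H.\<close>
  have comb: "(\<lambda>u. \<Sum>a\<in>B. c a * kernel_section S K (z a) u) \<in> H \<and>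
      (\<forall>f\<in>H. ip (\<lambda>u. \<Sum>a\<in>B. c a * kernel_section S K (z a) u) f = (\<Sum>a\<in>B. c a * f (z a)))"
    if "B \<subseteq> A" for B
    using finite_subset[OF that A(1)] that
  proof (induction B rule: finite_induct)
    case empty
    \<comment> \<open>Homogeneity with scalar 0.\<close>
    have "ip (\<lambda>u. 0) f = 0" if "f \<in> H" for f using D(7)[OF D(2) that, of 0] by simp
    then show ?case using D(2) by simp
  next
    case (insert a B)
    have sec: "kernel_section S K (z a) \<in> H"
      using insert A(2) D(10) by simp
    have "ip (kernel_section S K (z a)) f = f (z a)" if "f \<in> H" for f
      using D(11)[OF that, of "z a"] D(5)[OF that sec] insert A(2) by simp
    then show ?case
      using insert D(3)[OF D(4)[OF sec]] D(6)[OF D(4)[OF sec]] D(7)[OF sec] by simp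
  qed
  let ?f = "\<lambda>u. \<Sum>a\<in>A. c a * kernel_section S K (z a) u"
  have f: "?f \<in> H" "\<And>g. g \<in> H \<Longrightarrow> ip ?f g = (\<Sum>a\<in>A. c a * g (z a))"
    using comb[of A] by auto
  have "(rkhs_norm S K ?f)\<^sup>2 = ip ?f ?f"
    using D(8)[OF f(1)] by (simp add: rkhs_norm_def R)
  also have "\<dots> = (\<Sum>a\<in>A. \<Sum>b\<in>A. c a * c b * K (z a) (z b))"
    unfolding f(2)[OF f(1)]
    using A(2) by (simp add: kernel_section_def sum_distrib_left mult.assoc)
  finally show ?thesis .
qed

theorem theorem16:
  fixes n :: nat
    and X :: "nat \<Rightarrow> 'a set"
    and J :: "(nat \<Rightarrow> 'a) \<Rightarrow> (nat \<Rightarrow> 'a) \<Rightarrow> real"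
    and x :: "nat \<Rightarrow> nat \<Rightarrow> 'a"
  defines "S \<equiv> Pi\<^sub>E {1..n} X"
    and "K \<equiv> assoc_kernel n J (x 0)"
    and "I12 \<equiv> multi_indices n {1, 2}"
  assumes "\<And>i. i \<in> {1..n} \<Longrightarrow> X i \<noteq> {}"
    and "n_symmetric n X J"
    and "PDI n X J"
    and "\<And>u v. (u, v) \<in> extended_diagonal n X \<Longrightarrow> J u v = 0"
    and "x 0 \<in> S" and "x 1 \<in> S" and "x 2 \<in> S"
  shows "(rkhs_norm S K
            (\<lambda>u. \<Sum>\<alpha>\<in>I12. (-1) ^ multi_abs n \<alpha> * kernel_section S K (point_at n x \<alpha>) u))\<^sup>2
         = (\<Sum>\<alpha>\<in>I12. \<Sum>\<beta>\<in>I12. (-1) ^ (multi_abs n \<alpha> + multi_abs n \<beta>)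
              * K (point_at n x \<alpha>) (point_at n x \<beta>))
       \<and> (\<Sum>\<alpha>\<in>I12. \<Sum>\<beta>\<in>I12. (-1) ^ (multi_abs n \<alpha> + multi_abs n \<beta>)
              * K (point_at n x \<alpha>) (point_at n x \<beta>))
         = 2 ^ n * J (x 1) (x 2)"
proof
  \<comment> \<open>The two signs stay separate here, as the coefficients c a and c b of the general
    formula.\<close>
  have "(rkhs_norm S K (\<lambda>u. \<Sum>\<alpha>\<in>I12. (-1) ^ multi_abs n \<alpha> * kernel_section S K (point_at n x \<alpha>) u))\<^sup>2
      = (\<Sum>\<alpha>\<in>I12. \<Sum>\<beta>\<in>I12. (-1) ^ multi_abs n \<alpha> * (-1) ^ multi_abs n \<beta>
           * K (point_at n x \<alpha>) (point_at n x \<beta>))"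
  proof (rule rkhs_norm_sum_kernel_sections)
    show "K u v = K v u" if "u \<in> S" "v \<in> S" for u v
      using assoc_kernel_commute[OF \<open>n_symmetric n X J\<close>] \<open>x 0 \<in> S\<close> that by (simp add: S_def K_def)
    show "pos_def_kernel S K"
      using pos_def_assoc_kernel[OF \<open>PDI n X J\<close>] \<open>x 0 \<in> S\<close> by (simp add: S_def K_def)
    show "finite I12"
      by (simp add: I12_def finite_multi_indices)
    show "point_at n x \<alpha> \<in> S" if "\<alpha> \<in> I12" for \<alpha>
      unfolding S_def
      by (rule point_at_mem[OF that[unfolded I12_def]])
         (use \<open>x 1 \<in> S\<close> \<open>x 2 \<in> S\<close> in \<open>auto simp: S_def\<close>)
  qed
  then show "(rkhs_norm S K
            (\<lambda>u. \<Sum>\<alpha>\<in>I12. (-1) ^ multi_abs n \<alpha> * kernel_section S K (point_at n x \<alpha>) u))\<^sup>2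
         = (\<Sum>\<alpha>\<in>I12. \<Sum>\<beta>\<in>I12. (-1) ^ (multi_abs n \<alpha> + multi_abs n \<beta>)
              * K (point_at n x \<alpha>) (point_at n x \<beta>))"
    by (simp only: power_add)
  show "(\<Sum>\<alpha>\<in>I12. \<Sum>\<beta>\<in>I12. (-1) ^ (multi_abs n \<alpha> + multi_abs n \<beta>)
              * K (point_at n x \<alpha>) (point_at n x \<beta>))
         = 2 ^ n * J (x 1) (x 2)"
    \<comment> \<open>The base point \<open>x 0\<close> drops out here: only signed values of (-1)^n
      J at the corners remain.\<close>
    unfolding I12_def K_def assoc_kernel_alternating_sum
    using assms by (intro alternating_sum_off_diagonal) (auto simp: S_def)
qed

end
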